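(* Let $n\ge 3$, let $F$ be an algebraically closed field of characteristic zero, and let $R_n=F[x_1,\dots,x_n]$. Let $L_n\subseteq\mathbb Z^n$ be the lattice and $I_{L_n}\subset R_n$ the associated lattice ideal described in the context. Then there is a canonical $F$-algebra isomorphism $$R_n/I_{L_n}\cong F[\mathbb Z^n/L_n],$$ where $F[\mathbb Z^n/L_n]$ is the group algebra. In other words, if $I_{L_n}$ is of finite codimension in $R_n$, then its length is the same as the order of the group $\mathbb Z^n/L_n$; in this case $\operatorname{len}(R_n/I_{L_n})=|G_n|$.
   Context: Let $e_1,\dots,e_n$ be the canonical basis of $\mathbb Z^n$, and let $H$ be the Heaviside step function with the convention $H(0)=0$ (so $H(n-3)=0$ if $n=3$ and $H(n-3)=1$ if $n>3$). $L_n\subset\mathbb Z^n$ is the subgroup generated by $v_i=2e_i-\sum_{j=1}^n e_j$ for $1\le i\le n$, $v_{n+1}=(2n-4)e_n$, and $v_{i+n+1}=2e_i-2H(n-3)e_n$ for $1\le i\le n-1$. The associated lattice ideal is $$I_{L_n}=\Big\langle x_i-\prod_{j\ne i}x_j\ (1\le i\le n),\ \ x_n^{2n-4}-1,\ \ x_i^2-x_n^{2H(n-3)}\ (1\le i\le n-1)\Big\rangle\subset R_n.$$ "Canonical" refers to the $F$-algebra homomorphism sending the class of $x_i$ to the group-algebra basis element of the class of $e_i$ in $\mathbb Z^n/L_n$. $G_n$ is the group $\langle g_1,\dots,g_n\mid g_ig_j=g_jg_i\ (1\le i,j\le n),\ \prod_{j\ne k}g_j=g_k\ (1\le k\le n)\rangle$.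 The length (colength of the ideal) $\operatorname{len}(R_n/I_{L_n})$ is the length of $R_n/I_{L_n}$ as an $R_n$-module. *)

theory Defs
  imports
    "HOL-Algebra.Algebra"
    "HOL-Algebra.Free_Abelian_Groups"
    "HOL-Library.Poly_Mapping"
    "HOL-Library.Extended_Nat"
    "HOL-Computational_Algebra.Polynomial"
begin

text \<open>Variables are indexed by natural numbers; a monomial is its finitely supported exponent
  function.  The ring in the variables \<open>1, \<dots>, n\<close> is cut out of the ring of all
  polynomials in variables indexed by \<^typ>\<open>nat\<close>.\<close>

type_synonym 'a mpoly = "(nat \<Rightarrow>\<^sub>0 nat) \<Rightarrow>\<^sub>0 'a"

definition mvar :: "nat \<Rightarrow> 'a::field mpoly" where
  "mvar i = Poly_Mapping.single (Poly_Mapping.single i 1) 1"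

definition mconst :: "'a::field \<Rightarrow> 'a mpoly" where
  "mconst c = Poly_Mapping.single 0 c"

definition mpoly_ring :: "nat \<Rightarrow> 'a::field mpoly ring" where
  "mpoly_ring n =
    \<lparr>carrier = {p. \<forall>m \<in> Poly_Mapping.keys p. Poly_Mapping.keys m \<subseteq> {1..n}},
     monoid.mult = (*), monoid.one = 1, ring.zero = 0, ring.add = (+)\<rparr>"

text \<open>The ring \<open>S\<close> viewed as an algebra via a homomorphism \<open>f\<close> from the scalars to \<open>S\<close>.\<close>

definition algebra_via :: "'s ring \<Rightarrow> ('r \<Rightarrow> 's) \<Rightarrow> ('r, 's) module" where
  "algebra_via S f =
    \<lparr>carrier = carrier S, monoid.mult = monoid.mult S, monoid.one = \<one>\<^bsub>S\<^esub>, ring.zero = \<zero>\<^bsub>S\<^esub>,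
     ring.add = ring.add S,
     module.smult = (\<lambda>r s. f r \<otimes>\<^bsub>S\<^esub> s)\<rparr>"

text \<open>The set of isomorphisms of algebras over the field that consists of all elements of the
  scalar type.\<close>

definition algebra_iso ::
    "('a::field, 'b) module \<Rightarrow> ('a, 'c) module \<Rightarrow> ('b \<Rightarrow> 'c) set" where
  "algebra_iso A B =
    {h \<in> ring_iso A B. \<forall>c. \<forall>x \<in> carrier A. h (c \<odot>\<^bsub>A\<^esub> x) = c \<odot>\<^bsub>B\<^esub> h x}"

definition quotient_algebra :: "nat \<Rightarrow> 'a::field mpoly set \<Rightarrow> ('a, 'a mpoly set) module" where
  "quotient_algebra n I =
    algebra_via (mpoly_ring n Quot I) (\<lambda>c. I +>\<^bsub>mpoly_ring n\<^esub> mconst c)"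

text \<open>The field is embedded in the quotient ring as the set of classes of constants.\<close>

definition finite_codimension :: "nat \<Rightarrow> 'a::field mpoly set \<Rightarrow> bool" where
  "finite_codimension n I \<longleftrightarrow>
    ring.finite_dimension (mpoly_ring n Quot I)
      (range (\<lambda>c. I +>\<^bsub>mpoly_ring n\<^esub> mconst c)) (carrier (mpoly_ring n Quot I))"

text \<open>The length of an \<open>R\<close>-module is the supremum of the lengths \<open>k\<close> of strict chains
  \<open>C 0 \<subset> \<dots> \<subset> C k\<close> of submodules.\<close>

definition module_length :: "'r ring \<Rightarrow> ('r, 'm) module \<Rightarrow> enat" where
  "module_length R M =
    (SUP k \<in> {k. \<exists>C :: nat \<Rightarrow> 'm set.
        (\<forall>i\<le>k. submodule (C i) R M) \<and> (\<forall>i<k. C i \<subset> C (Suc i))}. enat k)"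

definition colength :: "'r ring \<Rightarrow> 'r set \<Rightarrow> enat" where
  "colength R I = module_length R (algebra_via (R Quot I) (\<lambda>r. I +>\<^bsub>R\<^esub> r))"

text \<open>Elements are finitely supported functions \<open>G \<rightarrow> F\<close> with the convolution product;
  the basis element of \<open>g\<close> is \<^term>\<open>Poly_Mapping.single g 1\<close>.  The group operation of \<open>G\<close> is
  that of the record, so the type class multiplication of \<^typ>\<open>'g \<Rightarrow>\<^sub>0 'a\<close> is not applicable.\<close>

definition group_algebra :: "'g monoid \<Rightarrow> ('a::field, 'g \<Rightarrow>\<^sub>0 'a) module" where
  "group_algebra G =
    \<lparr>carrier = {f. Poly_Mapping.keys f \<subseteq> carrier G},
     monoid.mult = (\<lambda>f h. \<Sum>x \<in> Poly_Mapping.keys f. \<Sum>y \<in> Poly_Mapping.keys h.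
        Poly_Mapping.single (x \<otimes>\<^bsub>G\<^esub> y) (Poly_Mapping.lookup f x * Poly_Mapping.lookup h y)),
     monoid.one = Poly_Mapping.single \<one>\<^bsub>G\<^esub> 1,
     ring.zero = 0,
     ring.add = (+),
     module.smult = (\<lambda>c. Poly_Mapping.map ((*) c))\<rparr>"

text \<open>A word is a list of letters; \<open>(g, True)\<close> stands for \<open>g\<close> and \<open>(g, False)\<close> for
  \<open>g\<inverse>\<close>.  A pair \<open>(u, v)\<close> in the set of relations stands for \<open>u = v\<close>.\<close>

type_synonym 'g word = "('g \<times> bool) list"

inductive_set word_cong :: "'g set \<Rightarrow> ('g word \<times> 'g word) set \<Rightarrow> ('g word \<times> 'g word) set"
  for S :: "'g set" and Rel :: "('g word \<times> 'g word) set" where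
  refl: "w \<in> lists (S \<times> UNIV) \<Longrightarrow> (w, w) \<in> word_cong S Rel"
| sym: "(u, v) \<in> word_cong S Rel \<Longrightarrow> (v, u) \<in> word_cong S Rel"
| trans: "(u, v) \<in> word_cong S Rel \<Longrightarrow> (v, w) \<in> word_cong S Rel \<Longrightarrow> (u, w) \<in> word_cong S Rel"
| append: "(u, u') \<in> word_cong S Rel \<Longrightarrow> (v, v') \<in> word_cong S Rel \<Longrightarrow>
    (u @ v, u' @ v') \<in> word_cong S Rel"
| cancel: "g \<in> S \<Longrightarrow> ([(g, b), (g, \<not> b)], []) \<in> word_cong S Rel"
| relation: "(u, v) \<in> Rel \<Longrightarrow> u \<in> lists (S \<times> UNIV) \<Longrightarrow> v \<in> lists (S \<times> UNIV) \<Longrightarrow>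
    (u, v) \<in> word_cong S Rel"

definition presented_group :: "'g set \<Rightarrow> ('g word \<times> 'g word) set \<Rightarrow> 'g word set monoid" where
  "presented_group S Rel =
    \<lparr>carrier = lists (S \<times> UNIV) // word_cong S Rel,
     monoid.mult = (\<lambda>A B. \<Union>u \<in> A. \<Union>v \<in> B. word_cong S Rel `` {u @ v}),
     monoid.one = word_cong S Rel `` {[]}\<rparr>"

lemma word_cong_lists:
  "(u, v) \<in> word_cong S Rel \<Longrightarrow> u \<in> lists (S \<times> UNIV) \<and> v \<in> lists (S \<times> UNIV)"
  by (induction rule: word_cong.induct) auto

lemma equiv_word_cong: "equiv (lists (S \<times> UNIV)) (word_cong S Rel)"
proof (rule equivI)
  show "word_cong S Rel \<subseteq> lists (S \<times> UNIV) \<times> lists (S \<times> UNIV)"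
    using word_cong_lists by fastforce
  show "refl_on (lists (S \<times> UNIV)) (word_cong S Rel)"
    by (auto simp: refl_on_def intro: word_cong.refl)
  show "Relation.sym (word_cong S Rel)"
    by (auto intro: symI word_cong.sym)
  show "Relation.trans (word_cong S Rel)"
    by (auto intro: transI word_cong.trans)
qed

lemma presented_group_mult:
  assumes "u \<in> lists (S \<times> UNIV)" "v \<in> lists (S \<times> UNIV)"
  shows "(word_cong S Rel `` {u}) \<otimes>\<^bsub>presented_group S Rel\<^esub> (word_cong S Rel `` {v})
    = word_cong S Rel `` {u @ v}"
proof -
  let ?c = "\<lambda>u. word_cong S Rel `` {u}"
  have const: "?c (u' @ v') = ?c (u @ v)" if "u' \<in> ?c u" "v' \<in> ?c v" for u' v'
    using equiv_class_eq[OF equiv_word_cong word_cong.append[of u u' S Rel v v']] that by simp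
  have mem: "u \<in> ?c u" "v \<in> ?c v"
    using word_cong.refl[OF assms(1)] word_cong.refl[OF assms(2)] by simp_all
  have "(\<Union>u' \<in> ?c u. \<Union>v' \<in> ?c v. ?c (u' @ v')) = ?c (u @ v)"
  proof (rule Set.equalityI)
    show "(\<Union>u' \<in> ?c u. \<Union>v' \<in> ?c v. ?c (u' @ v')) \<subseteq> ?c (u @ v)"
    proof (intro UN_least)
      fix u' v' assume "u' \<in> ?c u" "v' \<in> ?c v"
      then show "?c (u' @ v') \<subseteq> ?c (u @ v)" using const by (intro equalityD1)
    qed
    show "?c (u @ v) \<subseteq> (\<Union>u' \<in> ?c u. \<Union>v' \<in> ?c v. ?c (u' @ v'))"
      using mem by blast
  qed
  then show ?thesis
    by (simp add: presented_group_def)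
qed

lemma group_presented_group: "group (presented_group S Rel)"
proof -
  let ?W = "lists (S \<times> (UNIV :: bool set))"
  let ?c = "\<lambda>u. word_cong S Rel `` {u}"
  let ?G = "presented_group S Rel"
  have car: "A \<in> carrier ?G \<longleftrightarrow> (\<exists>u \<in> ?W. A = ?c u)" for A
    by (auto simp: presented_group_def quotient_def)
  have one: "\<one>\<^bsub>?G\<^esub> = ?c []"
    by (simp add: presented_group_def)
  have inv: "\<exists>v \<in> ?W. (v @ u, []) \<in> word_cong S Rel" if "u \<in> ?W" for u
    using that
  proof (induction u)
    case Nil
    then show ?case by (intro bexI[of _ "[]"]) (auto intro: word_cong.refl)
  next
    case (Cons a u)
    obtain g b where a: "a = (g, b)" by (cases a)
    from Cons obtain v where v: "v \<in> ?W" "(v @ u, []) \<in> word_cong S Rel" by auto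
    have g: "g \<in> S" "u \<in> ?W" using Cons a by auto
    have "([(g, \<not> b), (g, \<not> \<not> b)], []) \<in> word_cong S Rel"
      by (rule word_cong.cancel[OF g(1)])
    from word_cong.append[OF word_cong.refl[OF v(1)] word_cong.append[OF this word_cong.refl[OF g(2)]]]
    have "((v @ [(g, \<not> b)]) @ a # u, v @ u) \<in> word_cong S Rel"
      using a by simp
    then have "((v @ [(g, \<not> b)]) @ a # u, []) \<in> word_cong S Rel"
      using v(2) by (rule word_cong.trans)
    moreover have "v @ [(g, \<not> b)] \<in> ?W" using v g by simp
    ultimately show ?case by blast
  qed
  show ?thesis
  proof (rule groupI)
    show "x \<otimes>\<^bsub>?G\<^esub> y \<in> carrier ?G" if "x \<in> carrier ?G" "y \<in> carrier ?G" for x y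
    proof -
      obtain u v where uv: "u \<in> ?W" "v \<in> ?W" "x = ?c u" "y = ?c v"
        using \<open>x \<in> carrier ?G\<close> \<open>y \<in> carrier ?G\<close> unfolding car by blast
      have "x \<otimes>\<^bsub>?G\<^esub> y = ?c (u @ v)" "u @ v \<in> ?W"
        using presented_group_mult[OF uv(1,2)] uv by simp_all
      then show ?thesis
        unfolding car by blast
    qed
    show "\<one>\<^bsub>?G\<^esub> \<in> carrier ?G"
      unfolding car one using lists.Nil by blast
    show "x \<otimes>\<^bsub>?G\<^esub> y \<otimes>\<^bsub>?G\<^esub> z = x \<otimes>\<^bsub>?G\<^esub> (y \<otimes>\<^bsub>?G\<^esub> z)"
      if xyz: "x \<in> carrier ?G" "y \<in> carrier ?G" "z \<in> carrier ?G" for x y z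
    proof -
      obtain u v w where uvw: "u \<in> ?W" "v \<in> ?W" "w \<in> ?W" and eq: "x = ?c u" "y = ?c v" "z = ?c w"
        using xyz unfolding car by blast
      have "u @ v \<in> ?W" "v @ w \<in> ?W"
        using uvw by simp_all
      then show ?thesis
        unfolding eq by (simp only: presented_group_mult uvw append_assoc)
    qed
    show "\<one>\<^bsub>?G\<^esub> \<otimes>\<^bsub>?G\<^esub> x = x" if x: "x \<in> carrier ?G" for x
    proof -
      obtain u where u: "u \<in> ?W" "x = ?c u" using x unfolding car by blast
      then show ?thesis
        by (simp only: u(2) one presented_group_mult[OF lists.Nil u(1)] append_Nil)
    qed
    show "\<exists>y\<in>carrier ?G. y \<otimes>\<^bsub>?G\<^esub> x = \<one>\<^bsub>?G\<^esub>" if x: "x \<in> carrier ?G" for x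
    proof -
      obtain u where u: "u \<in> ?W" "x = ?c u" using x unfolding car by blast
      obtain v where v: "v \<in> ?W" "(v @ u, []) \<in> word_cong S Rel" using inv[OF u(1)] by blast
      have "?c v \<otimes>\<^bsub>?G\<^esub> x = \<one>\<^bsub>?G\<^esub>"
        by (simp only: u(2) one presented_group_mult[OF v(1) u(1)] equiv_class_eq[OF equiv_word_cong v(2)])
      moreover have "?c v \<in> carrier ?G" using v unfolding car by blast
      ultimately show ?thesis by blast
    qed
  qed
qed

text \<open>\<open>\<int>\<^sup>n\<close> is \<^term>\<open>free_Abelian_group {1..n}\<close>, written multiplicatively as a record but with
  pointwise addition; \<^term>\<open>frag_of i\<close> is the basis vector \<open>e\<^sub>i\<close>.\<close>

definition heaviside :: "int \<Rightarrow> nat" where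
  "heaviside k = (if k > 0 then 1 else 0)"

definition lattice_gens :: "nat \<Rightarrow> (nat \<Rightarrow>\<^sub>0 int) set" where
  "lattice_gens n =
    {frag_cmul 2 (frag_of i) - (\<Sum>j = 1..n. frag_of j) | i. i \<in> {1..n}}
    \<union> {frag_cmul (2 * int n - 4) (frag_of n)}
    \<union> {frag_cmul 2 (frag_of i) - frag_cmul (2 * int (heaviside (int n - 3))) (frag_of n)
        | i. i \<in> {1..n - 1}}"

definition lattice_L :: "nat \<Rightarrow> (nat \<Rightarrow>\<^sub>0 int) set" where
  "lattice_L n = generate (free_Abelian_group {1..n}) (lattice_gens n)"

definition lattice_quotient :: "nat \<Rightarrow> (nat \<Rightarrow>\<^sub>0 int) set monoid" where
  "lattice_quotient n = free_Abelian_group {1..n} Mod lattice_L n"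

definition lattice_ideal :: "nat \<Rightarrow> 'a::field mpoly set" where
  "lattice_ideal n = Idl\<^bsub>mpoly_ring n\<^esub>
    ({mvar i - (\<Prod>j \<in> {1..n} - {i}. mvar j) | i. i \<in> {1..n}}
    \<union> {mvar n ^ (2 * n - 4) - 1}
    \<union> {mvar i ^ 2 - mvar n ^ (2 * heaviside (int n - 3)) | i. i \<in> {1..n - 1}})"

definition G_group :: "nat \<Rightarrow> nat word set monoid" where
  "G_group n = presented_group {1..n}
    ({([(i, True), (j, True)], [(j, True), (i, True)]) | i j. i \<in> {1..n} \<and> j \<in> {1..n}}
    \<union> {(map (\<lambda>j. (j, True)) (filter (\<lambda>j. j \<noteq> k) [1..<Suc n]), [(k, True)]) | k. k \<in> {1..n}})"

end

theory Submission
  imports Defs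
begin

text \<open>
  Put \<open>M = 2n - 4\<close> and \<open>s = e\<^sub>1 + \<dots> + e\<^sub>n\<close>.  In \<open>\<int>\<^sup>n / L\<^sub>n\<close> the first family of generators says that
  \<open>2 e\<^sub>i = s\<close> for all \<open>i\<close>.  Summing over \<open>i\<close> gives \<open>(n - 2) s = 0\<close> and hence \<open>M e\<^sub>i = 0\<close>, from which
  the other two families follow (\<open>generators_from_first_family\<close>).  So the quotient is finite, every
  class contains the exponent of a monomial, and \<open>\<int>\<^sup>n / L\<^sub>n\<close> has the same defining relations as the
  abelian group \<open>G\<^sub>n\<close> (\<open>cong_G_iff\<close>).

  The generators of the ideal \<open>I\<close> are the binomials \<open>x\<^sup>a - x\<^sup>b\<close> for which \<open>a - b\<close> runs over the
  generators of \<open>L\<^sub>n\<close>.  Modulo \<open>I\<close> every variable satisfies \<open>x\<^sub>i\<^sup>M = 1\<close>, so monomials are units and can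
  be cancelled; therefore \<open>x\<^sup>a - x\<^sup>b \<in> I\<close> whenever \<open>a - b \<in> L\<^sub>n\<close> (\<open>binomial_in_lattice_ideal\<close>).
  The linear map that sends the monomial \<open>x\<^sup>m\<close> to the class of \<open>m\<close> is multiplicative and maps onto the
  group algebra.  Its kernel is \<open>I\<close>: up to elements of \<open>I\<close>, a polynomial can be rewritten with one
  monomial for each class, and on such polynomials the map is injective.  This is the isomorphism
  (\<open>lattice_algebra_iso\<close>).

  It shows that \<open>R / I\<close> has dimension \<open>|\<int>\<^sup>n / L\<^sub>n|\<close> over the field, and it remains to see that the length
  equals the dimension (\<open>colength_eq_card_basis\<close>).  A chain of ideals is a chain of subspaces, so
  the length is at most the dimension.  Conversely, let \<open>J\<close> be a proper ideal that contains \<open>I\<close>.  The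
  variables act on \<open>R / J\<close> by commuting operators, each of which satisfies a polynomial equation, and over an
  algebraically closed field these have a common eigenvector \<open>w\<close> (\<open>common_eigenvector\<close>).  Then
  \<open>J + F w\<close> is an ideal whose dimension modulo \<open>J\<close> is one.  Repeating this leads from \<open>I\<close> to \<open>R\<close> in
  as many steps as the dimension.
\<close>

section \<open>Polynomials in the variables 1 to n\<close>

abbreviation monomial :: "(nat \<Rightarrow>\<^sub>0 nat) \<Rightarrow> 'a::field mpoly" where
  "monomial m \<equiv> Poly_Mapping.single m 1"

lemma mpoly_ring_simps [simp]:
  "p \<otimes>\<^bsub>mpoly_ring n\<^esub> q = p * q" "p \<oplus>\<^bsub>mpoly_ring n\<^esub> q = p + q"
  "\<one>\<^bsub>mpoly_ring n\<^esub> = 1" "\<zero>\<^bsub>mpoly_ring n\<^esub> = 0"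
  by (simp_all add: mpoly_ring_def)

lemma carrier_mpoly_ring:
  "p \<in> carrier (mpoly_ring n) \<longleftrightarrow>
    (\<forall>m \<in> Poly_Mapping.keys p. Poly_Mapping.keys m \<subseteq> {1..n})"
  by (simp add: mpoly_ring_def)

lemma single_in_mpoly_ring:
  "Poly_Mapping.keys m \<subseteq> {1..n} \<Longrightarrow> Poly_Mapping.single m c \<in> carrier (mpoly_ring n)"
  by (simp add: carrier_mpoly_ring)

lemma mconst_in_mpoly_ring [simp]: "mconst c \<in> carrier (mpoly_ring n)"
  by (simp add: carrier_mpoly_ring mconst_def)

lemma mvar_in_mpoly_ring: "i \<in> {1..n} \<Longrightarrow> mvar i \<in> carrier (mpoly_ring n)"
  by (simp add: carrier_mpoly_ring mvar_def)

lemma mconst_simps [simp]: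
  "mconst 0 = 0" "mconst 1 = 1" "mconst (a + b) = mconst a + mconst b"
  "mconst (a * b) = mconst a * mconst b" "mconst (- a) = - mconst a"
  by (simp_all add: mconst_def single_add mult_single single_uminus)

lemma cring_mpoly_ring: "cring (mpoly_ring n :: 'a::field mpoly ring)"
proof (rule cringI)
  show "abelian_group (mpoly_ring n :: 'a mpoly ring)"
  proof (rule abelian_groupI)
    fix p :: "'a mpoly" assume "p \<in> carrier (mpoly_ring n)"
    then show "\<exists>q \<in> carrier (mpoly_ring n). q \<oplus>\<^bsub>mpoly_ring n\<^esub> p = \<zero>\<^bsub>mpoly_ring n\<^esub>"
      by (intro bexI[of _ "- p"]) (auto simp: carrier_mpoly_ring in_keys_iff)
  next
    fix p q :: "'a mpoly"
    assume "p \<in> carrier (mpoly_ring n)" "q \<in> carrier (mpoly_ring n)"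
    then show "p \<oplus>\<^bsub>mpoly_ring n\<^esub> q \<in> carrier (mpoly_ring n)"
      using keys_add[of p q] by (fastforce simp: carrier_mpoly_ring)
  qed (auto simp: carrier_mpoly_ring algebra_simps)
  show "comm_monoid (mpoly_ring n :: 'a mpoly ring)"
  proof (rule comm_monoidI)
    fix p q :: "'a mpoly"
    assume pq: "p \<in> carrier (mpoly_ring n)" "q \<in> carrier (mpoly_ring n)"
    have "Poly_Mapping.keys m \<subseteq> {1..n}" if "m \<in> Poly_Mapping.keys (p * q)" for m
    proof -
      have "m \<in> {a + b | a b. a \<in> Poly_Mapping.keys p \<and> b \<in> Poly_Mapping.keys q}"
        using subsetD[OF keys_mult[of p q] that] .
      then obtain a b where "m = a + b" "a \<in> Poly_Mapping.keys p" "b \<in> Poly_Mapping.keys q"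
        by blast
      then show ?thesis
        using pq keys_add[of a b] unfolding carrier_mpoly_ring by blast
    qed
    then show "p \<otimes>\<^bsub>mpoly_ring n\<^esub> q \<in> carrier (mpoly_ring n)"
      by (simp add: carrier_mpoly_ring)
  qed (auto simp: carrier_mpoly_ring algebra_simps)
qed (simp add: algebra_simps)

lemma a_inv_mpoly_ring:
  assumes "p \<in> carrier (mpoly_ring n)"
  shows "\<ominus>\<^bsub>mpoly_ring n\<^esub> p = - p"
proof -
  interpret R: cring "mpoly_ring n" by (rule cring_mpoly_ring)
  have "- p \<in> carrier (mpoly_ring n)"
    using assms by (simp add: carrier_mpoly_ring)
  then show ?thesis
    using assms by (intro R.minus_equality) auto
qed

lemma mvar_power: "mvar i ^ k = monomial (Poly_Mapping.single i k)"
proof (induction k)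
  case (Suc k)
  then show ?case
    using single_add[of i 1 k] by (simp add: mvar_def mult_single)
qed simp

lemma poly_mapping_sum_singles:
  "f = (\<Sum>k \<in> Poly_Mapping.keys f. Poly_Mapping.single k (Poly_Mapping.lookup f k))"
  by (rule poly_mapping_eqI)
    (auto simp: lookup_sum lookup_single when_def in_keys_iff sum.delta)

lemma poly_mapping_additive_induct [case_names single zero add]:
  fixes p :: "'k \<Rightarrow>\<^sub>0 'a::comm_monoid_add"
  assumes "\<And>k c. k \<in> Poly_Mapping.keys p \<Longrightarrow> P (Poly_Mapping.single k c)"
    and "P 0" and "\<And>p q. P p \<Longrightarrow> P q \<Longrightarrow> P (p + q)"
  shows "P p"
proof -
  have "P (\<Sum>k \<in> A. Poly_Mapping.single k (Poly_Mapping.lookup p k))"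
    if "finite A" "A \<subseteq> Poly_Mapping.keys p" for A
    using that by (induction A) (simp_all add: assms)
  from this[OF finite_keys order_refl] show ?thesis
    by (simp only: poly_mapping_sum_singles[of p, symmetric])
qed

lemma monomial_induct:
  fixes P :: "'a::field mpoly \<Rightarrow> bool"
  assumes "Poly_Mapping.keys m \<subseteq> {1..n}" and "P 1"
    and "\<And>p i. P p \<Longrightarrow> i \<in> {1..n} \<Longrightarrow> P (mvar i * p)"
  shows "P (monomial m)"
proof -
  have pow: "P (mvar i ^ k * p)" if "P p" "i \<in> {1..n}" for i k p
    using that by (induction k) (auto intro: assms(3) simp: mult.assoc)
  have "P (monomial (\<Sum>i \<in> A. Poly_Mapping.single i (g i)))" if "finite A" "A \<subseteq> {1..n}"
    for A g using that
  proof (induction A)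
    case (insert i A)
    then have "monomial (\<Sum>i \<in> insert i A. Poly_Mapping.single i (g i)) =
        (mvar i ^ g i * monomial (\<Sum>i \<in> A. Poly_Mapping.single i (g i)) :: 'a mpoly)"
      by (simp add: mult_single mvar_power)
    moreover have "P (monomial (\<Sum>i \<in> A. Poly_Mapping.single i (g i)))"
      using insert by simp
    ultimately show ?case using insert.prems pow by simp
  qed (simp add: assms(2))
  from this[OF finite_keys assms(1), of "Poly_Mapping.lookup m"] show ?thesis
    by (simp only: poly_mapping_sum_singles[of m, symmetric])
qed

lemma mpoly_ring_induct [consumes 1, case_names const var add mult]:
  assumes p: "p \<in> carrier (mpoly_ring n)"
    and const: "\<And>c. P (mconst c)" and var: "\<And>i. i \<in> {1..n} \<Longrightarrow> P (mvar i)"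
    and add: "\<And>p q. P p \<Longrightarrow> P q \<Longrightarrow> P (p + q)"
    and mult: "\<And>p q. P p \<Longrightarrow> P q \<Longrightarrow> P (p * q)"
  shows "P p"
proof (rule poly_mapping_additive_induct[of p])
  fix m c assume m: "m \<in> Poly_Mapping.keys p"
  have "P (monomial m)"
  proof (rule monomial_induct[of m n])
    show "Poly_Mapping.keys m \<subseteq> {1..n}"
      using m p by (simp add: carrier_mpoly_ring)
    show "P 1" using const[of 1] by simp
  qed (rule mult[OF var])
  from mult[OF const this, of c] show "P (Poly_Mapping.single m c)"
    by (simp add: mconst_def mult_single)
qed (use const[of 0] add in simp_all)

section \<open>Length as the maximal length of chains of ideals\<close>

text \<open>The scalars act on the quotient through the surjection from \<open>R\<close> to \<open>R / I\<close>, so stability under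
  scalars is stability under multiplication by arbitrary elements of the quotient.\<close>

lemma submodule_quotient_iff_ideal:
  assumes "cring R" "ideal I R"
  shows "submodule N R (algebra_via (R Quot I) (\<lambda>r. I +>\<^bsub>R\<^esub> r)) \<longleftrightarrow> ideal N (R Quot I)"
proof -
  interpret R: cring R by fact
  interpret I: ideal I R by fact
  interpret Q: cring "R Quot I" by (rule I.quotient_is_cring[OF assms(1)])
  let ?M = "algebra_via (R Quot I) (\<lambda>r. I +>\<^bsub>R\<^esub> r)"
  have add: "subgroup N (add_monoid ?M) \<longleftrightarrow> subgroup N (add_monoid (R Quot I))"
    by (simp add: algebra_via_def subgroup_def m_inv_def)
  have car: "carrier (R Quot I) = (\<lambda>r. I +>\<^bsub>R\<^esub> r) ` carrier R"
    by (auto simp: FactRing_simps)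
  have smult: "r \<odot>\<^bsub>?M\<^esub> x = (I +>\<^bsub>R\<^esub> r) \<otimes>\<^bsub>R Quot I\<^esub> x" for r x
    by (simp add: algebra_via_def)
  show ?thesis
  proof
    assume N: "submodule N R ?M"
    then interpret N: submodule N R ?M .
    have sub: "subgroup N (add_monoid (R Quot I))"
      using N.subgroup_axioms by (simp add: add)
    then have le: "N \<subseteq> carrier (R Quot I)"
      using subgroup.subset by fastforce
    show "ideal N (R Quot I)"
    proof (rule idealI[OF Q.ring_axioms sub])
      fix a x assume ax: "a \<in> N" "x \<in> carrier (R Quot I)"
      then show l: "x \<otimes>\<^bsub>R Quot I\<^esub> a \<in> N"
        using N.smult_closed by (auto simp: car smult)
      with ax le show "a \<otimes>\<^bsub>R Quot I\<^esub> x \<in> N"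
        by (metis Q.m_comm subsetD)
    qed
  next
    assume N: "ideal N (R Quot I)"
    then interpret N: ideal N "R Quot I" .
    show "submodule N R ?M"
      unfolding submodule_def submodule_axioms_def add smult
      using N.a_subgroup N.I_l_closed car by blast
  qed
qed

text \<open>The correspondence between the ideals of \<open>R / I\<close> and the ideals of \<open>R\<close> that contain \<open>I\<close>
  preserves and reflects strict inclusion.  It moves the computation of the length from cosets to
  subsets of \<open>R\<close>.\<close>

lemma colength_eq_SUP_ideal_chains:
  assumes "cring R" "ideal I R"
  shows "colength R I = (SUP k \<in> {k. \<exists>C :: nat \<Rightarrow> _.
    (\<forall>i\<le>k. ideal (C i) R \<and> I \<subseteq> C i) \<and> (\<forall>i<k. C i \<subset> C (Suc i))}. enat k)"
proof -
  interpret R: cring R by fact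
  let ?h = "\<lambda>J. (+>\<^bsub>R\<^esub>) I ` J"
  let ?X = "{J. ideal J R \<and> I \<subseteq> J}" and ?Y = "{J. ideal J (R Quot I)}"
  have bij: "bij_betw ?h ?X ?Y"
    by (rule R.quot_ideal_correspondence[OF assms(2)])
  have strict: "?h J \<subset> ?h J' \<longleftrightarrow> J \<subset> J'" if "J \<in> ?X" "J' \<in> ?X" for J J'
  proof -
    have union: "J = \<Union> (?h J)" if "J \<in> ?X" for J
      using that R.ideal_incl_iff[OF assms(2), of J] by blast
    have mono: "?h J \<subseteq> ?h J' \<longleftrightarrow> J \<subseteq> J'" if J: "J \<in> ?X" "J' \<in> ?X" for J J'
    proof
      assume "?h J \<subseteq> ?h J'"
      then show "J \<subseteq> J'"
        by (subst union[OF J(1)], subst union[OF J(2)]) (rule Union_mono)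
    qed (rule image_mono)
    show ?thesis
      unfolding less_le_not_le mono[OF that] mono[OF that(2,1)] ..
  qed
  have "(\<exists>C. (\<forall>i\<le>k. C i \<in> ?Y) \<and> (\<forall>i<k. C i \<subset> C (Suc i))) \<longleftrightarrow>
        (\<exists>C. (\<forall>i\<le>k. C i \<in> ?X) \<and> (\<forall>i<k. C i \<subset> C (Suc i)))" (is "?l \<longleftrightarrow> ?r") for k :: nat
  proof
    assume ?l
    then obtain C where C: "\<And>i. i \<le> k \<Longrightarrow> C i \<in> ?Y" "\<And>i. i < k \<Longrightarrow> C i \<subset> C (Suc i)"
      by blast
    define D where "D i = inv_into ?X ?h (C i)" for i
    have D: "D i \<in> ?X" "?h (D i) = C i" if "i \<le> k" for i
    proof -
      have "C i \<in> ?h ` ?X"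
        using C(1)[OF that] bij by (simp only: bij_betw_imp_surj_on)
      then show "D i \<in> ?X" "?h (D i) = C i"
        unfolding D_def by (rule inv_into_into, rule f_inv_into_f)
    qed
    have "D i \<subset> D (Suc i)" if "i < k" for i
      using strict[OF D(1) D(1)] D(2) C(2) that by simp
    with D show ?r by blast
  next
    assume ?r
    then obtain C where C: "\<And>i. i \<le> k \<Longrightarrow> C i \<in> ?X" "\<And>i. i < k \<Longrightarrow> C i \<subset> C (Suc i)"
      by blast
    have "?h (C i) \<in> ?Y" if "i \<le> k" for i
      using C(1)[OF that] bij_betwE[OF bij] by blast
    moreover have "?h (C i) \<subset> ?h (C (Suc i))" if "i < k" for i
      using strict[OF C(1) C(1)] C(2) that by simp
    ultimately show ?l by (intro exI[of _ "\<lambda>i. ?h (C i)"] conjI allI impI)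
  qed
  then show ?thesis
    by (simp add: colength_def module_length_def submodule_quotient_iff_ideal[OF assms])
qed

lemma ideal_mpoly_ringD:
  assumes "ideal J (mpoly_ring n)"
  shows "J \<subseteq> carrier (mpoly_ring n)" "0 \<in> J"
    and "p \<in> J \<Longrightarrow> q \<in> J \<Longrightarrow> p + q \<in> J"
    and "p \<in> carrier (mpoly_ring n) \<Longrightarrow> q \<in> J \<Longrightarrow> p * q \<in> J"
    and "p \<in> J \<Longrightarrow> q \<in> J \<Longrightarrow> p - q \<in> J"
proof -
  note sub = ideal.axioms(1)[OF assms]
  show "J \<subseteq> carrier (mpoly_ring n)"
    by (rule additive_subgroup.a_subset[OF sub])
  show "0 \<in> J"
    using additive_subgroup.zero_closed[OF sub] by simp
  show add: "p + q \<in> J" if "p \<in> J" "q \<in> J" for p q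
    using additive_subgroup.a_closed[OF sub that] by simp
  show mult: "p * q \<in> J" if "p \<in> carrier (mpoly_ring n)" "q \<in> J" for p q
    using ideal.I_l_closed[OF assms that(2,1)] by simp
  show "p - q \<in> J" if "p \<in> J" "q \<in> J"
    using add[OF that(1) mult[OF mconst_in_mpoly_ring[of "- 1"] that(2)]] by simp
qed

lemma ideal_mpoly_ringI:
  assumes sub: "J \<subseteq> carrier (mpoly_ring n)" and zero: "0 \<in> J"
    and add: "\<And>p q. p \<in> J \<Longrightarrow> q \<in> J \<Longrightarrow> p + q \<in> J"
    and mult: "\<And>p q. p \<in> carrier (mpoly_ring n) \<Longrightarrow> q \<in> J \<Longrightarrow> p * q \<in> J"
  shows "ideal J (mpoly_ring n)"
proof -
  interpret R: cring "mpoly_ring n" by (rule cring_mpoly_ring)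
  show ?thesis
  proof (rule idealI)
    show "subgroup J (add_monoid (mpoly_ring n))"
    proof (rule R.add.subgroupI)
      show "J \<subseteq> carrier (mpoly_ring n)" by (rule sub)
      show "J \<noteq> {}"
        using zero by blast
      show "p \<oplus>\<^bsub>mpoly_ring n\<^esub> q \<in> J" if "p \<in> J" "q \<in> J" for p q
        using add[OF that] by simp
      show "\<ominus>\<^bsub>mpoly_ring n\<^esub> p \<in> J" if p: "p \<in> J" for p
        using a_inv_mpoly_ring[OF subsetD[OF sub p]] mult[OF mconst_in_mpoly_ring[of "- 1"] p]
        by simp
    qed
    show "p \<otimes>\<^bsub>mpoly_ring n\<^esub> q \<in> J" "q \<otimes>\<^bsub>mpoly_ring n\<^esub> p \<in> J"
      if "q \<in> J" "p \<in> carrier (mpoly_ring n)" for p q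
      using mult[OF that(2,1)] by (simp_all add: mult.commute)
  qed (rule R.ring_axioms)
qed

section \<open>Common eigenvectors and the length over an algebraically closed field\<close>

abbreviation poly_at :: "'a::field poly \<Rightarrow> 'a mpoly \<Rightarrow> 'a mpoly" where
  "poly_at f x \<equiv> poly (map_poly mconst f) x"

lemma poly_at_in_mpoly_ring:
  assumes "x \<in> carrier (mpoly_ring n)"
  shows "poly_at f x \<in> carrier (mpoly_ring n)"
proof -
  interpret R: cring "mpoly_ring n" by (rule cring_mpoly_ring)
  show ?thesis
  proof (induction f)
    case 0
    show ?case using R.zero_closed by simp
  next
    case (pCons c f)
    then show ?case
      using R.a_closed[OF mconst_in_mpoly_ring R.m_closed[OF assms]]
      by (simp add: map_poly_pCons)
  qed
qed

lemma poly_at_linear_factor: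
  "poly_at ([:- \<zeta>, 1:] * f) x = (x - mconst \<zeta>) * poly_at f x"
proof -
  have "map_poly mconst ([:- \<zeta>, 1:] * f) = pCons 0 (map_poly mconst f) - smult (mconst \<zeta>) (map_poly mconst f)"
    by (rule poly_eqI) (simp add: coeff_map_poly coeff_pCons mconst_def single_diff mult_single split: nat.split)
  then show ?thesis by (simp only:) (simp add: algebra_simps)
qed

text \<open>Among the nonzero polynomials \<open>g\<close> with \<open>g(x) v \<in> J\<close> take one of least degree.  It is not
  constant because \<open>v \<notin> J\<close>, so it has a linear factor, and by minimality its cofactor \<open>h\<close>
  satisfies \<open>h(x) v \<notin> J\<close>.  That the eigenvector is a multiple of \<open>v\<close> is what allows several
  operators to be treated in succession.\<close>

lemma eigenvector_of_algebraic:
  fixes J :: "'a::alg_closed_field mpoly set"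
  assumes J: "ideal J (mpoly_ring n)" and x: "x \<in> carrier (mpoly_ring n)"
    and v: "v \<in> carrier (mpoly_ring n) - J" and f: "f \<noteq> 0" "poly_at f x \<in> J"
  shows "\<exists>q \<in> carrier (mpoly_ring n). \<exists>\<zeta>. q * v \<notin> J \<and> (x - mconst \<zeta>) * (q * v) \<in> J"
proof -
  note J = ideal_mpoly_ringD[OF J]
  define annihilates where "annihilates g \<longleftrightarrow> g \<noteq> 0 \<and> poly_at g x * v \<in> J" for g
  have "annihilates f"
    using f J(4)[of v "poly_at f x"] v by (simp add: annihilates_def mult.commute[of v])
  then obtain g where g: "annihilates g" and least: "\<And>h. annihilates h \<Longrightarrow> degree g \<le> degree h"
    using exists_least_iff[of "\<lambda>k. \<exists>g. annihilates g \<and> degree g = k"]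
    by (metis not_le)
  have "degree g \<noteq> 0"
  proof
    assume "degree g = 0"
    then obtain c where c: "g = [:c:]" by (rule degree_eq_zeroE)
    then have "c \<noteq> 0" and cv: "mconst c * v \<in> J"
      using g by (simp_all add: annihilates_def map_poly_pCons)
    have "mconst (inverse c) * (mconst c * v) \<in> J"
      by (rule J(4)[OF mconst_in_mpoly_ring cv])
    also have "mconst (inverse c) * (mconst c * v) = mconst (inverse c * c) * v"
      by (simp only: mconst_simps mult.assoc)
    finally show False using v \<open>c \<noteq> 0\<close> by simp
  qed
  then obtain \<zeta> where "poly g \<zeta> = 0"
    using alg_closed_imp_poly_has_root[of g] by auto
  then obtain h where h: "g = [:- \<zeta>, 1:] * h"
    unfolding poly_eq_0_iff_dvd by (rule dvdE)
  have "h \<noteq> 0" using g h by (auto simp: annihilates_def)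
  then have "degree g = Suc (degree h)"
    unfolding h by (subst degree_mult_eq) auto
  then have "\<not> annihilates h" using least[of h] by auto
  then have "poly_at h x * v \<notin> J"
    using \<open>h \<noteq> 0\<close> by (simp add: annihilates_def)
  moreover have "(x - mconst \<zeta>) * (poly_at h x * v) \<in> J"
    using g unfolding annihilates_def h poly_at_linear_factor by (simp add: mult.assoc)
  ultimately show ?thesis
    using poly_at_in_mpoly_ring[OF x] by blast
qed

text \<open>The variables are treated one after the other.  Each new vector is a multiple of the preceding
  one, so it remains an eigenvector of the earlier variables.  The elements of the ring that have
  \<open>w\<close> as an eigenvector modulo \<open>J\<close> form a subalgebra, which contains the variables and is therefore
  the whole ring.\<close>

lemma common_eigenvector:
  fixes J :: "'a::alg_closed_field mpoly set"
  assumes J: "ideal J (mpoly_ring n)" and proper: "J \<noteq> carrier (mpoly_ring n)"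
    and alg: "\<And>i. i \<in> {1..n} \<Longrightarrow> \<exists>f. f \<noteq> 0 \<and> poly_at f (mvar i) \<in> J"
  shows "\<exists>w \<in> carrier (mpoly_ring n) - J. \<forall>p \<in> carrier (mpoly_ring n). \<exists>\<zeta>. (p - mconst \<zeta>) * w \<in> J"
proof -
  interpret R: cring "mpoly_ring n :: 'a mpoly ring" by (rule cring_mpoly_ring)
  note JD = ideal_mpoly_ringD[OF J]
  have "\<exists>w \<in> carrier (mpoly_ring n) - J. \<forall>i \<in> {1..k}. \<exists>\<zeta>. (mvar i - mconst \<zeta>) * w \<in> J"
    if "k \<le> n" for k
    using that
  proof (induction k)
    case 0
    then show ?case using JD(1) proper by auto
  next
    case (Suc k)
    then obtain w where w: "w \<in> carrier (mpoly_ring n) - J"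
      and eig: "\<forall>i \<in> {1..k}. \<exists>\<zeta>. (mvar i - mconst \<zeta>) * w \<in> J" by auto
    have k: "Suc k \<in> {1..n}" using Suc.prems by simp
    obtain f where "f \<noteq> 0" "poly_at f (mvar (Suc k)) \<in> J" using alg[OF k] by blast
    then obtain q \<zeta> where q: "q \<in> carrier (mpoly_ring n)" "q * w \<notin> J"
        "(mvar (Suc k) - mconst \<zeta>) * (q * w) \<in> J"
      using eigenvector_of_algebraic[OF J mvar_in_mpoly_ring[OF k] w] by blast
    have "\<exists>\<zeta>. (mvar i - mconst \<zeta>) * (q * w) \<in> J" if i: "i \<in> {1..Suc k}" for i
    proof (cases "i = Suc k")
      case False
      then obtain \<xi> where "(mvar i - mconst \<xi>) * w \<in> J" using eig i by force
      from JD(4)[OF q(1) this] show ?thesis by (auto simp: mult.left_commute)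
    qed (use q in blast)
    moreover have "q * w \<in> carrier (mpoly_ring n)"
      using R.m_closed[OF q(1)] w by simp
    ultimately show ?case using q(2) by blast
  qed
  from this[OF order_refl] obtain w where w: "w \<in> carrier (mpoly_ring n)" "w \<notin> J"
    and eig: "\<And>i. i \<in> {1..n} \<Longrightarrow> \<exists>\<zeta>. (mvar i - mconst \<zeta>) * w \<in> J" by blast
  have "p \<in> carrier (mpoly_ring n) \<and> (\<exists>\<zeta>. (p - mconst \<zeta>) * w \<in> J)"
    if "p \<in> carrier (mpoly_ring n)" for p
    using that
  proof (induction p rule: mpoly_ring_induct)
    case (const c)
    have "(mconst c - mconst c) * w \<in> J" using JD(2) by simp
    then show ?case using mconst_in_mpoly_ring by blast
  next
    case (var i)
    then show ?case using eig mvar_in_mpoly_ring by blast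
  next
    case (add p q)
    then obtain \<zeta> \<xi> where "(p - mconst \<zeta>) * w \<in> J" "(q - mconst \<xi>) * w \<in> J" by blast
    from JD(3)[OF this] have "(p + q - mconst (\<zeta> + \<xi>)) * w \<in> J"
      by (simp add: algebra_simps)
    moreover have "p + q \<in> carrier (mpoly_ring n)"
      using add R.a_closed[of p q] by simp
    ultimately show ?case by blast
  next
    case (mult p q)
    then obtain \<zeta> \<xi> where z: "(p - mconst \<zeta>) * w \<in> J" and x: "(q - mconst \<xi>) * w \<in> J" by blast
    from JD(3)[OF JD(4)[OF conjunct1[OF mult(1)] x] JD(4)[OF mconst_in_mpoly_ring[of \<xi>] z]]
    have "(p * q - mconst (\<zeta> * \<xi>)) * w \<in> J"
      by (simp add: algebra_simps)
    moreover have "p * q \<in> carrier (mpoly_ring n)"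
      using mult R.m_closed[of p q] by simp
    ultimately show ?case by blast
  qed
  with w show ?thesis by blast
qed

text \<open>Length equals dimension.  The map \<open>\<pi>\<close> identifies the quotient by \<open>I\<close> with the span of \<open>B\<close>.
  Choosing an element in every step of a strict chain of ideals gives independent vectors, so no
  chain has more than \<open>card B\<close> steps.  A chain of exactly that many steps is built by adjoining common
  eigenvectors: a step adds at most one dimension to the image, so the construction cannot stop
  earlier.\<close>

theorem colength_eq_card_basis:
  fixes I :: "'a::alg_closed_field mpoly set" and scale :: "'a \<Rightarrow> 'b::ab_group_add \<Rightarrow> 'b"
  assumes I: "ideal I (mpoly_ring n)"
    and alg: "\<And>i. i \<in> {1..n} \<Longrightarrow> \<exists>f. f \<noteq> 0 \<and> poly_at f (mvar i) \<in> I"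
    and lin: "Vector_Spaces.linear (\<lambda>c p. mconst c * p) scale \<pi>"
    and ker: "\<And>p. p \<in> carrier (mpoly_ring n) \<Longrightarrow> \<pi> p = 0 \<longleftrightarrow> p \<in> I"
    and B: "finite B" "\<not> module.dependent scale B"
    and img: "\<pi> ` carrier (mpoly_ring n) = module.span scale B"
  shows "colength (mpoly_ring n) I = enat (card B)"
proof -
  interpret R: cring "mpoly_ring n :: 'a mpoly ring" by (rule cring_mpoly_ring)
  interpret \<pi>: Vector_Spaces.linear "\<lambda>c p. mconst c * p" scale \<pi> by fact
  define chain :: "nat \<Rightarrow> (nat \<Rightarrow> 'a mpoly set) \<Rightarrow> bool" where
    "chain k C \<longleftrightarrow> (\<forall>i\<le>k. ideal (C i) (mpoly_ring n) \<and> I \<subseteq> C i) \<and> (\<forall>i<k. C i \<subset> C (Suc i))" for k C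
  have upper: "k \<le> card B" if "chain k C" for k C
  proof -
    have C: "ideal (C i) (mpoly_ring n)" "I \<subseteq> C i" if "i \<le> k" for i
      using that \<open>chain k C\<close> by (simp_all add: chain_def)
    have image_sub: "\<pi>.vs2.subspace (\<pi> ` C i)" if "i \<le> k" for i
    proof -
      have "\<pi>.vs1.subspace (C i)"
        using ideal_mpoly_ringD[OF C(1)[OF that]] by (intro \<pi>.vs1.subspaceI) auto
      then show ?thesis by (rule \<pi>.subspace_image)
    qed
    have "\<exists>S. \<pi>.vs2.independent S \<and> finite S \<and> card S = j \<and> S \<subseteq> \<pi> ` C j" if "j \<le> k" for j
      using that
    proof (induction j)
      case 0
      show ?case by (intro exI[of _ "{}"]) (simp add: \<pi>.vs2.independent_empty)
    next
      case (Suc j)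
      then obtain S where S: "\<pi>.vs2.independent S" "finite S" "card S = j" "S \<subseteq> \<pi> ` C j" by auto
      have lt: "C j \<subset> C (Suc j)" using \<open>chain k C\<close> Suc.prems by (simp add: chain_def)
      then obtain w where w: "w \<in> C (Suc j)" "w \<notin> C j" by blast
      have "\<pi> w \<notin> \<pi>.vs2.span S"
      proof
        assume "\<pi> w \<in> \<pi>.vs2.span S"
        then have "\<pi> w \<in> \<pi> ` C j"
          using \<pi>.vs2.span_minimal[OF S(4) image_sub] Suc.prems by auto
        then obtain c where c: "c \<in> C j" "\<pi> w = \<pi> c" by blast
        have "w - c \<in> C (Suc j)"
          using ideal_mpoly_ringD(5)[OF C(1)[OF Suc.prems]] w c lt by blast
        then have "w - c \<in> carrier (mpoly_ring n)"
          using ideal_mpoly_ringD(1)[OF C(1)[OF Suc.prems]] by blast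
        moreover have "\<pi> (w - c) = 0" using c by (simp add: \<pi>.diff)
        ultimately have "w - c \<in> C j" using ker C(2)[of j] Suc.prems by auto
        from ideal_mpoly_ringD(3)[OF C(1) this c(1)] have "w \<in> C j" using Suc.prems by simp
        with w show False by blast
      qed
      then have "\<pi>.vs2.independent (insert (\<pi> w) S)" "\<pi> w \<notin> S"
        using S(1) \<pi>.vs2.independent_insertI \<pi>.vs2.span_base by blast+
      moreover have "insert (\<pi> w) S \<subseteq> \<pi> ` C (Suc j)" using w S(4) lt by blast
      ultimately show ?case
        using S by (intro exI[of _ "insert (\<pi> w) S"]) simp
    qed
    from this[OF order_refl] obtain S where S: "\<pi>.vs2.independent S" "card S = k" "S \<subseteq> \<pi> ` C k"
      by blast
    then have "S \<subseteq> \<pi>.vs2.span B"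
      using ideal_mpoly_ringD(1)[OF C(1)[OF order_refl]] img by blast
    from \<pi>.vs2.independent_span_bound[OF B(1) S(1) this] show ?thesis using S(2) by simp
  qed
  have lower: "\<exists>C. chain j C \<and> (\<exists>S. finite S \<and> card S \<le> j \<and> \<pi> ` C j \<subseteq> \<pi>.vs2.span S)"
    if "j \<le> card B" for j
    using that
  proof (induction j)
    case 0
    have "chain 0 (\<lambda>_. I)" using I by (simp add: chain_def)
    moreover have "\<pi> ` I \<subseteq> \<pi>.vs2.span {}"
      using ker ideal_mpoly_ringD(1)[OF I] by auto
    ultimately show ?case by (intro exI[of _ "\<lambda>_. I"] conjI exI[of _ "{}"]) auto
  next
    case (Suc j)
    then obtain C S where C: "chain j C" and S: "finite S" "card S \<le> j" "\<pi> ` C j \<subseteq> \<pi>.vs2.span S"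
      by auto
    have J: "ideal (C j) (mpoly_ring n)" and IJ: "I \<subseteq> C j" using C by (simp_all add: chain_def)
    note JD = ideal_mpoly_ringD[OF J]
    have "C j \<noteq> carrier (mpoly_ring n)"
    proof
      assume "C j = carrier (mpoly_ring n)"
      then have "B \<subseteq> \<pi>.vs2.span S"
        using S(3) img \<pi>.vs2.span_superset[of B] by auto
      from \<pi>.vs2.independent_span_bound[OF S(1) B(2) this] show False
        using S(2) Suc.prems by simp
    qed
    from common_eigenvector[OF J this] obtain w :: "'a mpoly" where
      w: "w \<in> carrier (mpoly_ring n)" "w \<notin> C j" and
      eig: "\<And>p :: 'a mpoly. p \<in> carrier (mpoly_ring n) \<Longrightarrow> \<exists>\<zeta>. (p - mconst \<zeta>) * w \<in> C j"
      using alg IJ by blast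
    \<comment> \<open>The subspace spanned by \<open>C j\<close> and \<open>w\<close>; it is an ideal because every element of the ring acts
      on \<open>w\<close> as a scalar modulo \<open>C j\<close>.\<close>
    define J' where "J' = {a + mconst c * w | a c. a \<in> C j}"
    have J'I: "a + mconst c * w \<in> J'" if "a \<in> C j" for a c
      using that by (auto simp: J'_def)
    have "ideal J' (mpoly_ring n)"
    proof (rule ideal_mpoly_ringI)
      show "J' \<subseteq> carrier (mpoly_ring n)"
        using JD(1) R.a_closed R.m_closed[OF mconst_in_mpoly_ring w(1)] by (auto simp: J'_def)
      show "0 \<in> J'" using J'I[OF JD(2), of 0] by simp
    next
      fix p q assume "p \<in> J'" "q \<in> J'"
      then obtain a c b d where "p = a + mconst c * w" "q = b + mconst d * w" "a \<in> C j" "b \<in> C j"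
        by (auto simp: J'_def)
      then show "p + q \<in> J'"
        using J'I[OF JD(3), of a b "c + d"] by (simp add: algebra_simps)
    next
      fix p q :: "'a mpoly" assume p: "p \<in> carrier (mpoly_ring n)" and "q \<in> J'"
      then obtain a c where q: "q = a + mconst c * w" "a \<in> C j" by (auto simp: J'_def)
      obtain \<zeta> where "(p - mconst \<zeta>) * w \<in> C j" using eig[OF p] by blast
      from JD(3)[OF JD(4)[OF p q(2)] JD(4)[OF mconst_in_mpoly_ring[of c] this]]
      show "p * q \<in> J'"
        using J'I[of _ "c * \<zeta>"] q(1) by (force simp: algebra_simps)
    qed
    moreover have sub: "C j \<subseteq> J'" using J'I[of _ 0] by auto
    moreover have "w \<in> J'" using J'I[OF JD(2), of 1] by simp
    ultimately have "chain (Suc j) (C(Suc j := J'))"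
      using C IJ w(2) by (auto simp: chain_def le_Suc_eq less_Suc_eq)
    moreover have "\<pi> ` J' \<subseteq> \<pi>.vs2.span (insert (\<pi> w) S)"
    proof
      fix y assume "y \<in> \<pi> ` J'"
      then obtain a c where y: "y = \<pi> (a + mconst c * w)" "a \<in> C j" by (auto simp: J'_def)
      have "\<pi> a \<in> \<pi>.vs2.span (insert (\<pi> w) S)"
        using S(3) y(2) \<pi>.vs2.span_mono[of S "insert (\<pi> w) S"] by blast
      then show "y \<in> \<pi>.vs2.span (insert (\<pi> w) S)"
        unfolding y(1) \<pi>.add \<pi>.scale
        by (intro \<pi>.vs2.span_add \<pi>.vs2.span_scale) (auto intro: \<pi>.vs2.span_base)
    qed
    moreover have "card (insert (\<pi> w) S) \<le> Suc j"
      using S(1,2) by (simp add: card_insert_if)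
    ultimately show ?case
      using S(1) by (intro exI[of _ "C(Suc j := J')"] conjI exI[of _ "insert (\<pi> w) S"])
        (simp_all only: fun_upd_same finite_insert)
  qed
  have "colength (mpoly_ring n) I = (SUP k \<in> {k. \<exists>C. chain k C}. enat k)"
    unfolding colength_eq_SUP_ideal_chains[OF cring_mpoly_ring I] chain_def ..
  also have "\<dots> = enat (card B)"
  proof (rule antisym)
    show "(SUP k \<in> {k. \<exists>C. chain k C}. enat k) \<le> enat (card B)"
      using upper by (intro SUP_least) auto
    show "enat (card B) \<le> (SUP k \<in> {k. \<exists>C. chain k C}. enat k)"
      using lower[OF order_refl] by (intro SUP_upper) auto
  qed
  finally show ?thesis .
qed

section \<open>The lattice and its quotient\<close>

abbreviation int_exponent :: "(nat \<Rightarrow>\<^sub>0 nat) \<Rightarrow> (nat \<Rightarrow>\<^sub>0 int)" where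
  "int_exponent \<equiv> Poly_Mapping.map int"

lemma lookup_int_exponent [simp]:
  "Poly_Mapping.lookup (int_exponent m) i = int (Poly_Mapping.lookup m i)"
  by (simp add: Poly_Mapping.map.rep_eq when_def)

lemma int_exponent_simps [simp]:
  "int_exponent 0 = 0" "int_exponent (a + b) = int_exponent a + int_exponent b"
  by (auto intro!: poly_mapping_eqI simp: lookup_add)

lemma keys_int_exponent [simp]: "Poly_Mapping.keys (int_exponent m) = Poly_Mapping.keys m"
  by (auto simp: in_keys_iff)

lemma int_exponent_single: "int_exponent (Poly_Mapping.single i k) = frag_cmul (int k) (frag_of i)"
  by (rule poly_mapping_eqI) (simp add: lookup_single when_def)

lemma int_exponent_sum: "int_exponent (sum f A) = (\<Sum>i\<in>A. int_exponent (f i))"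
  by (induction A rule: infinite_finite_induct) auto

text \<open>The rules of a subgroup of \<open>\<int>\<^sup>n\<close> in the additive notation of exponents.  They are applied to
  the lattice itself, to the kernel of a homomorphism, and to the set of exponent differences of
  the binomials in an ideal.\<close>

locale exponent_subgroup =
  fixes n :: nat and K :: "(nat \<Rightarrow>\<^sub>0 int) set"
  assumes subgroup: "subgroup K (free_Abelian_group {1..n})"
begin

lemma keys: "d \<in> K \<Longrightarrow> Poly_Mapping.keys d \<subseteq> {1..n}"
  using subgroup.subset[OF subgroup] by (auto simp: subset_iff)

lemma zero: "0 \<in> K"
  using subgroup.one_closed[OF subgroup] by simp

lemma add: "d \<in> K \<Longrightarrow> e \<in> K \<Longrightarrow> d + e \<in> K"
  using subgroup.m_closed[OF subgroup, of d e] by simp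

lemma uminus: "d \<in> K \<Longrightarrow> - d \<in> K"
  using subgroup.m_inv_closed[OF subgroup, of d] keys[of d] by simp

lemma diff: "d \<in> K \<Longrightarrow> e \<in> K \<Longrightarrow> d - e \<in> K"
  using add[OF _ uminus, of d e] by simp

lemma cmul: "d \<in> K \<Longrightarrow> frag_cmul c d \<in> K"
  by (rule frag_closure_minus_cmul) (auto intro: zero diff)

lemma sum: "(\<And>i. i \<in> A \<Longrightarrow> f i \<in> K) \<Longrightarrow> sum f A \<in> K"
  by (induction A rule: infinite_finite_induct) (auto intro: zero add)

end

lemma lookup_sum_frag_of:
  "finite A \<Longrightarrow> Poly_Mapping.lookup (\<Sum>j\<in>A. frag_of j) k = (if k \<in> A then 1 else 0)"
  by (simp add: lookup_sum)

text \<open>The vectors \<open>v\<^sub>i = 2 e\<^sub>i - s\<close> with \<open>s = e\<^sub>1 + \<dots> + e\<^sub>n\<close> already generate \<open>L\<^sub>n\<close>: their sum is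
  \<open>(2 - n) s\<close>, and \<open>(2n - 4) e\<^sub>i = (n - 2) v\<^sub>i + (n - 2) s\<close>.  For \<open>n = 3\<close> the sum is \<open>- s\<close>, which gives
  \<open>2 e\<^sub>i = v\<^sub>i + s\<close>; for larger \<open>n\<close> use \<open>2 e\<^sub>i - 2 e\<^sub>n = v\<^sub>i - v\<^sub>n\<close>.\<close>

lemma generators_from_first_family:
  assumes K: "exponent_subgroup n K" and n: "n \<ge> 3"
    and v: "\<And>i. i \<in> {1..n} \<Longrightarrow> frag_cmul 2 (frag_of i) - (\<Sum>j = 1..n. frag_of j) \<in> K"
  shows "i \<in> {1..n} \<Longrightarrow> frag_cmul (2 * int n - 4) (frag_of i) \<in> K" and "lattice_gens n \<subseteq> K"
proof -
  interpret exponent_subgroup n K by fact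
  let ?s = "\<Sum>j = 1..n. frag_of j :: nat \<Rightarrow>\<^sub>0 int"
  have "(\<Sum>i = 1..n. frag_cmul 2 (frag_of i) - ?s) = frag_cmul (2 - int n) ?s"
    by (rule poly_mapping_eqI,
        simp only: lookup_sum lookup_minus lookup_frag_cmul lookup_frag_of,
        simp add: sum_subtractf flip: sum_distrib_left)
  moreover have "(\<Sum>i = 1..n. frag_cmul 2 (frag_of i) - ?s) \<in> K"
    by (rule sum) (rule v)
  ultimately have s: "frag_cmul (2 - int n) ?s \<in> K" by simp
  show mult: "frag_cmul (2 * int n - 4) (frag_of i) \<in> K" if i: "i \<in> {1..n}" for i
  proof -
    have "frag_cmul (2 * int n - 4) (frag_of i) =
        frag_cmul (int n - 2) (frag_cmul 2 (frag_of i) - ?s) - frag_cmul (2 - int n) ?s"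
      by (rule poly_mapping_eqI) (simp add: lookup_minus algebra_simps)
    also have "\<dots> \<in> K" by (intro diff cmul v i s)
    finally show ?thesis .
  qed
  have third: "frag_cmul 2 (frag_of i) - frag_cmul (2 * int (heaviside (int n - 3))) (frag_of n) \<in> K"
    if "i \<in> {1..n - 1}" for i
  proof (cases "n = 3")
    case True
    have "frag_cmul 2 (frag_of i) = (frag_cmul 2 (frag_of i) - ?s) - frag_cmul (2 - int n) ?s"
      by (rule poly_mapping_eqI) (simp add: lookup_minus True)
    also have "\<dots> \<in> K" using that by (intro diff v s) auto
    finally show ?thesis by (simp add: True heaviside_def)
  next
    case False
    have "(frag_cmul 2 (frag_of i) - ?s) - (frag_cmul 2 (frag_of n) - ?s) \<in> K"
      using that n by (intro diff v) auto
    then show ?thesis using n False by (simp add: heaviside_def del: minus_frag_cmul)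
  qed
  show "lattice_gens n \<subseteq> K"
    unfolding lattice_gens_def using v mult[of n] third n by auto
qed

lemma exponent_subgroup_lattice_L:
  assumes "n \<ge> 3"
  shows "exponent_subgroup n (lattice_L n)"
proof (rule exponent_subgroup.intro)
  let ?Z = "carrier (free_Abelian_group {1..n})"
  interpret Z: exponent_subgroup n ?Z
    by (rule exponent_subgroup.intro) (rule group.subgroup_self[OF group_free_Abelian_group])
  have e: "frag_of i \<in> ?Z" if "i \<in> {1..n}" for i
    using that by simp
  have "lattice_gens n \<subseteq> ?Z"
    by (rule generators_from_first_family(2)[OF Z.exponent_subgroup_axioms assms])
      (intro Z.diff Z.cmul Z.sum e)
  then show "subgroup (lattice_L n) (free_Abelian_group {1..n})"
    unfolding lattice_L_def by (rule group.generate_is_subgroup[OF group_free_Abelian_group])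
qed

lemma lattice_L_subset:
  assumes "exponent_subgroup n K" "lattice_gens n \<subseteq> K"
  shows "lattice_L n \<subseteq> K"
  unfolding lattice_L_def
  by (rule group.generate_subgroup_incl[OF group_free_Abelian_group assms(2)
        exponent_subgroup.subgroup[OF assms(1)]])

lemma lattice_gens_subset_L: "lattice_gens n \<subseteq> lattice_L n"
  unfolding lattice_L_def by (auto intro: generate.incl)

definition lattice_class :: "nat \<Rightarrow> (nat \<Rightarrow>\<^sub>0 int) \<Rightarrow> (nat \<Rightarrow>\<^sub>0 int) set" where
  "lattice_class n d = lattice_L n #>\<^bsub>free_Abelian_group {1..n}\<^esub> d"

lemma lattice_class_eq_iff:
  assumes "n \<ge> 3" "Poly_Mapping.keys d \<subseteq> {1..n}" "Poly_Mapping.keys e \<subseteq> {1..n}"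
  shows "lattice_class n d = lattice_class n e \<longleftrightarrow> d - e \<in> lattice_L n"
proof -
  let ?Z = "free_Abelian_group {1..n}"
  have sub: "subgroup (lattice_L n) ?Z"
    by (rule exponent_subgroup.subgroup[OF exponent_subgroup_lattice_L[OF assms(1)]])
  have "lattice_class n d = lattice_class n e \<longleftrightarrow> d \<in> lattice_class n e"
    using group.rcos_self[OF group_free_Abelian_group _ sub, of d]
      group.repr_independence[OF group_free_Abelian_group _ _ sub, of d e] assms
    by (auto simp: lattice_class_def)
  also have "\<dots> \<longleftrightarrow> d \<otimes>\<^bsub>?Z\<^esub> inv\<^bsub>?Z\<^esub> e \<in> lattice_L n"
    unfolding lattice_class_def using assms by (intro subgroup.rcos_module[OF sub group_free_Abelian_group]) auto
  finally show ?thesis using assms by simp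
qed

lemma carrier_lattice_quotient:
  "carrier (lattice_quotient n) = lattice_class n ` {d. Poly_Mapping.keys d \<subseteq> {1..n}}"
  by (auto simp: lattice_quotient_def FactGroup_def RCOSETS_def lattice_class_def)

lemma lattice_class_mult:
  assumes "n \<ge> 3" "Poly_Mapping.keys d \<subseteq> {1..n}" "Poly_Mapping.keys e \<subseteq> {1..n}"
  shows "lattice_class n d \<otimes>\<^bsub>lattice_quotient n\<^esub> lattice_class n e = lattice_class n (d + e)"
proof -
  have "lattice_L n \<lhd> free_Abelian_group {1..n}"
    by (rule comm_group.subgroup_imp_normal[OF abelian_free_Abelian_group
          exponent_subgroup.subgroup[OF exponent_subgroup_lattice_L[OF assms(1)]]])
  from normal.rcos_sum[OF this, of d e] show ?thesis
    using assms by (simp add: lattice_quotient_def FactGroup_def lattice_class_def)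
qed

lemma one_lattice_quotient:
  assumes "n \<ge> 3"
  shows "\<one>\<^bsub>lattice_quotient n\<^esub> = lattice_class n 0"
proof -
  have "lattice_L n \<subseteq> carrier (free_Abelian_group {1..n})"
    by (rule subgroup.subset[OF exponent_subgroup.subgroup[OF exponent_subgroup_lattice_L[OF assms]]])
  from group.coset_mult_one[OF group_free_Abelian_group this] show ?thesis
    by (simp add: lattice_quotient_def FactGroup_def lattice_class_def)
qed

text \<open>Since \<open>(2n - 4) e\<^sub>i\<close> lies in the lattice, every coordinate can be reduced modulo \<open>2n - 4\<close>.
  The reduced representative is nonnegative, so it is the exponent of a monomial, and there are
  only finitely many of them.\<close>

lemma lattice_class_reduced_exponent:
  assumes n: "n \<ge> 3" and d: "Poly_Mapping.keys d \<subseteq> {1..n}"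
  shows "\<exists>m. Poly_Mapping.keys m \<subseteq> {1..n} \<and> (\<forall>i. Poly_Mapping.lookup m i < 2 * n - 4) \<and>
    lattice_class n (int_exponent m) = lattice_class n d"
proof -
  interpret L: exponent_subgroup n "lattice_L n"
    by (rule exponent_subgroup_lattice_L[OF n])
  define M where "M = 2 * n - 4"
  have M: "M > 0" and intM: "int M = 2 * int n - 4" using n by (auto simp: M_def)
  define m where "m = (\<Sum>i = 1..n. Poly_Mapping.single i (nat (Poly_Mapping.lookup d i mod int M)))"
  have look: "Poly_Mapping.lookup m i = (if i \<in> {1..n} then nat (Poly_Mapping.lookup d i mod int M) else 0)"
    for i by (simp add: m_def lookup_sum lookup_single when_def)
  have keys: "Poly_Mapping.keys m \<subseteq> {1..n}"
    by (auto simp: in_keys_iff look split: if_splits)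
  have d0: "Poly_Mapping.lookup d i = 0" if "i \<notin> {1..n}" for i
    using d that by (metis in_keys_iff subsetD)
  have M_e: "frag_cmul (int M) (frag_of i) \<in> lattice_L n" if "i \<in> {1..n}" for i
    unfolding intM using lattice_gens_subset_L[of n] that
    by (intro generators_from_first_family(1)[OF L.exponent_subgroup_axioms n])
      (auto simp: lattice_gens_def)
  have "d - int_exponent m =
      (\<Sum>i = 1..n. frag_cmul (Poly_Mapping.lookup d i div int M) (frag_cmul (int M) (frag_of i)))"
  proof (rule poly_mapping_eqI)
    fix k
    show "Poly_Mapping.lookup (d - int_exponent m) k = Poly_Mapping.lookup
      (\<Sum>i = 1..n. frag_cmul (Poly_Mapping.lookup d i div int M) (frag_cmul (int M) (frag_of i))) k"
    proof (cases "k \<in> {1..n}")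
      case True
      have "Poly_Mapping.lookup d k - Poly_Mapping.lookup d k mod int M =
          Poly_Mapping.lookup d k div int M * int M"
        by (rule minus_mod_eq_div_mult)
      then show ?thesis
        using True M by (simp add: lookup_sum lookup_minus look if_distrib[of "(*) _"] cong: if_cong)
    qed (auto simp: lookup_sum lookup_minus look d0 intro!: sum.neutral)
  qed
  also have "\<dots> \<in> lattice_L n"
    by (intro L.sum L.cmul[of "frag_cmul _ (frag_of _)"] M_e)
  finally have "lattice_class n d = lattice_class n (int_exponent m)"
    using lattice_class_eq_iff[OF n d] keys by simp
  moreover have "Poly_Mapping.lookup m i < M" for i
    using M by (simp add: look nat_less_iff)
  ultimately show ?thesis
    using keys unfolding M_def by auto
qed

lemma finite_lattice_quotient:
  assumes "n \<ge> 3"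
  shows "finite (carrier (lattice_quotient n))"
proof -
  let ?F = "{f. \<forall>i. (i \<in> {1..n} \<longrightarrow> f i \<in> {..<2 * n - 4}) \<and> (i \<notin> {1..n} \<longrightarrow> f i = 0)}"
  have "carrier (lattice_quotient n) \<subseteq> (\<lambda>f. lattice_class n (int_exponent (Abs_poly_mapping f))) ` ?F"
  proof
    fix c
    assume "c \<in> carrier (lattice_quotient n)"
    then obtain d where d: "Poly_Mapping.keys d \<subseteq> {1..n}" "c = lattice_class n d"
      by (auto simp: carrier_lattice_quotient)
    obtain m where "Poly_Mapping.keys m \<subseteq> {1..n}" "\<forall>i. Poly_Mapping.lookup m i < 2 * n - 4"
        "c = lattice_class n (int_exponent m)"
      using lattice_class_reduced_exponent[OF assms d(1)] d(2) by auto
    then show "c \<in> (\<lambda>f. lattice_class n (int_exponent (Abs_poly_mapping f))) ` ?F"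
      by (intro image_eqI[of _ _ "Poly_Mapping.lookup m"])
        (auto simp: lookup_inverse in_keys_iff subset_iff)
  qed
  moreover have "finite ?F"
    by (rule finite_set_of_finite_funs) auto
  ultimately show ?thesis by (rule finite_surj[rotated])
qed

section \<open>Linear maps between monomial bases and the group algebra\<close>

definition push_forward :: "('k \<Rightarrow> 'l) \<Rightarrow> ('k \<Rightarrow>\<^sub>0 'a::field) \<Rightarrow> ('l \<Rightarrow>\<^sub>0 'a)" where
  "push_forward f p = (\<Sum>k \<in> Poly_Mapping.keys p. Poly_Mapping.single (f k) (Poly_Mapping.lookup p k))"

lemma push_forward_zero [simp]: "push_forward f 0 = 0"
  by (simp add: push_forward_def)

lemma push_forward_single [simp]:
  "push_forward f (Poly_Mapping.single k c) = Poly_Mapping.single (f k) c"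
  by (simp add: push_forward_def)

lemma push_forward_add: "push_forward f (p + q) = push_forward f p + push_forward f q"
  unfolding push_forward_def by (rule setsum_keys_plus_distrib) (simp_all add: single_add)

lemma keys_push_forward: "Poly_Mapping.keys (push_forward f p) \<subseteq> f ` Poly_Mapping.keys p"
  unfolding push_forward_def
  by (rule order_trans[OF keys_sum]) (auto split: if_splits)

abbreviation scalar_mult :: "'a::field \<Rightarrow> ('k \<Rightarrow>\<^sub>0 'a) \<Rightarrow> ('k \<Rightarrow>\<^sub>0 'a)" where
  "scalar_mult c \<equiv> Poly_Mapping.map ((*) c)"

lemma lookup_scalar_mult [simp]:
  "Poly_Mapping.lookup (scalar_mult c p) k = c * Poly_Mapping.lookup p k"
  by (simp add: Poly_Mapping.map.rep_eq when_def)

lemma scalar_mult_single [simp]: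
  "scalar_mult c (Poly_Mapping.single k d) = Poly_Mapping.single k (c * d)"
  by (rule poly_mapping_eqI) (simp add: lookup_single when_def)

lemma vector_space_scalar_mult: "vector_space (scalar_mult :: 'a::field \<Rightarrow> ('k \<Rightarrow>\<^sub>0 'a) \<Rightarrow> _)"
  by unfold_locales (auto intro!: poly_mapping_eqI simp: lookup_add algebra_simps)

lemma linear_push_forward:
  "Vector_Spaces.linear (\<lambda>c p. mconst c * p) scalar_mult (push_forward f)"
proof -
  have "push_forward f (mconst c * p) = scalar_mult c (push_forward f p)" for c :: 'a and p
  proof (induction p rule: poly_mapping_additive_induct)
    case (add p q)
    then show ?case
      by (auto intro!: poly_mapping_eqI simp: push_forward_add lookup_add distrib_left)
  qed (auto intro!: poly_mapping_eqI simp: mconst_def mult_single)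
  moreover have "vector_space (\<lambda>(c :: 'a) p. mconst c * p)"
    by unfold_locales (simp_all add: algebra_simps)
  ultimately show ?thesis
    unfolding Vector_Spaces.linear_def module_hom_def module_hom_axioms_def module_iff_vector_space
    using vector_space_scalar_mult by (auto simp: push_forward_add)
qed

lemma group_algebra_simps [simp]:
  "carrier (group_algebra G) = {f. Poly_Mapping.keys f \<subseteq> carrier G}"
  "\<one>\<^bsub>group_algebra G\<^esub> = Poly_Mapping.single \<one>\<^bsub>G\<^esub> 1" "\<zero>\<^bsub>group_algebra G\<^esub> = 0"
  "f \<oplus>\<^bsub>group_algebra G\<^esub> h = f + h" "c \<odot>\<^bsub>group_algebra G\<^esub> f = scalar_mult c f"
  by (simp_all add: group_algebra_def)

lemma group_algebra_mult:
  "f \<otimes>\<^bsub>group_algebra G\<^esub> h = (\<Sum>x \<in> Poly_Mapping.keys f. \<Sum>y \<in> Poly_Mapping.keys h.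
    Poly_Mapping.single (x \<otimes>\<^bsub>G\<^esub> y) (Poly_Mapping.lookup f x * Poly_Mapping.lookup h y))"
  by (simp add: group_algebra_def)

lemma group_algebra_mult_add:
  "(f + g) \<otimes>\<^bsub>group_algebra G\<^esub> h = f \<otimes>\<^bsub>group_algebra G\<^esub> h + g \<otimes>\<^bsub>group_algebra G\<^esub> h"
  "h \<otimes>\<^bsub>group_algebra G\<^esub> (f + g) = h \<otimes>\<^bsub>group_algebra G\<^esub> f + h \<otimes>\<^bsub>group_algebra G\<^esub> g"
proof -
  show "(f + g) \<otimes>\<^bsub>group_algebra G\<^esub> h = f \<otimes>\<^bsub>group_algebra G\<^esub> h + g \<otimes>\<^bsub>group_algebra G\<^esub> h"
    unfolding group_algebra_mult
    by (rule setsum_keys_plus_distrib) (simp_all add: distrib_right single_add sum.distrib)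
  show "h \<otimes>\<^bsub>group_algebra G\<^esub> (f + g) = h \<otimes>\<^bsub>group_algebra G\<^esub> f + h \<otimes>\<^bsub>group_algebra G\<^esub> g"
    unfolding group_algebra_mult sum.swap[of _ _ "Poly_Mapping.keys h"]
    by (rule setsum_keys_plus_distrib) (simp_all add: distrib_left single_add sum.distrib)
qed

lemma group_algebra_mult_zero [simp]:
  "0 \<otimes>\<^bsub>group_algebra G\<^esub> h = 0" "h \<otimes>\<^bsub>group_algebra G\<^esub> 0 = 0"
  by (simp_all add: group_algebra_mult)

lemma group_algebra_mult_single:
  "Poly_Mapping.single x a \<otimes>\<^bsub>group_algebra G\<^esub> Poly_Mapping.single y b =
    Poly_Mapping.single (x \<otimes>\<^bsub>G\<^esub> y) (a * b)"
  by (simp add: group_algebra_mult)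

text \<open>Both sides are additive in each of \<open>p\<close> and \<open>q\<close>, so it suffices to compare them on single basis
  elements.\<close>

lemma push_forward_mult:
  assumes f: "\<And>k l. k \<in> Poly_Mapping.keys p \<Longrightarrow> l \<in> Poly_Mapping.keys q \<Longrightarrow> f (k + l) = f k \<otimes>\<^bsub>G\<^esub> f l"
  shows "push_forward f (p * q) = push_forward f p \<otimes>\<^bsub>group_algebra G\<^esub> push_forward f q"
proof (rule poly_mapping_additive_induct[of p])
  fix k c
  assume k: "k \<in> Poly_Mapping.keys p"
  show "push_forward f (Poly_Mapping.single k c * q) =
      push_forward f (Poly_Mapping.single k c) \<otimes>\<^bsub>group_algebra G\<^esub> push_forward f q"
  proof (rule poly_mapping_additive_induct[of q])
    fix l d
    assume "l \<in> Poly_Mapping.keys q"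
    with f[OF k] show "push_forward f (Poly_Mapping.single k c * Poly_Mapping.single l d) =
      push_forward f (Poly_Mapping.single k c) \<otimes>\<^bsub>group_algebra G\<^esub> push_forward f (Poly_Mapping.single l d)"
      by (simp add: mult_single group_algebra_mult_single)
  qed (simp_all add: push_forward_add group_algebra_mult_add distrib_left)
qed (simp_all add: push_forward_add group_algebra_mult_add distrib_right)

lemma group_algebra_basis:
  fixes A :: "'k set"
  assumes "finite A"
  defines "B \<equiv> (\<lambda>g. Poly_Mapping.single g (1 :: 'a::field)) ` A"
  shows "\<not> module.dependent scalar_mult B"
    and "module.span scalar_mult B = {f. Poly_Mapping.keys f \<subseteq> A}"
    and "finite B" and "card B = card A"
proof -
  interpret V: vector_space "scalar_mult :: 'a \<Rightarrow> ('k \<Rightarrow>\<^sub>0 'a) \<Rightarrow> _"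
    by (rule vector_space_scalar_mult)
  have inj: "inj_on (\<lambda>g. Poly_Mapping.single g (1 :: 'a)) A"
  proof (rule inj_onI)
    fix g h :: 'k
    assume "Poly_Mapping.single g (1 :: 'a) = Poly_Mapping.single h 1"
    then have "Poly_Mapping.keys (Poly_Mapping.single g (1 :: 'a)) = Poly_Mapping.keys (Poly_Mapping.single h (1 :: 'a))"
      by (rule arg_cong)
    then show "g = h" by simp
  qed
  show fin: "finite B" and "card B = card A"
    using assms card_image[OF inj] by (simp_all add: B_def)
  show "V.independent B"
  proof (rule V.independent_if_scalars_zero[OF fin])
    fix u x
    assume zero: "(\<Sum>x\<in>B. scalar_mult (u x) x) = 0" and "x \<in> B"
    then obtain g where g: "g \<in> A" "x = Poly_Mapping.single g 1" by (auto simp: B_def)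
    have "Poly_Mapping.lookup (\<Sum>x\<in>B. scalar_mult (u x) x) g = u x"
      unfolding B_def sum.reindex[OF inj] lookup_sum
      using g assms(1) by (simp add: lookup_single when_def)
    with zero show "u x = 0" by simp
  qed
  show "V.span B = {f. Poly_Mapping.keys f \<subseteq> A}"
  proof (rule antisym)
    have "V.subspace {f. Poly_Mapping.keys f \<subseteq> A}"
    proof (rule V.subspaceI)
      fix f h :: "'k \<Rightarrow>\<^sub>0 'a"
      assume "f \<in> {f. Poly_Mapping.keys f \<subseteq> A}" "h \<in> {f. Poly_Mapping.keys f \<subseteq> A}"
      then show "f + h \<in> {f. Poly_Mapping.keys f \<subseteq> A}"
        using keys_add[of f h] by blast
    qed (auto simp: in_keys_iff)
    then show "V.span B \<subseteq> {f. Poly_Mapping.keys f \<subseteq> A}"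
      by (intro V.span_minimal) (auto simp: B_def)
    show "{f. Poly_Mapping.keys f \<subseteq> A} \<subseteq> V.span B"
    proof
      fix f :: "'k \<Rightarrow>\<^sub>0 'a"
      assume f: "f \<in> {f. Poly_Mapping.keys f \<subseteq> A}"
      show "f \<in> V.span B"
      proof (rule poly_mapping_additive_induct[of f])
        fix k c assume "k \<in> Poly_Mapping.keys f"
        then have "Poly_Mapping.single k 1 \<in> B" using f by (auto simp: B_def)
        from V.span_scale[OF V.span_base[OF this], of c]
        show "Poly_Mapping.single k c \<in> V.span B" by simp
      qed (auto intro: V.span_add V.span_zero)
    qed
  qed
qed

section \<open>The lattice ideal\<close>

text \<open>The exponents \<open>(a, b)\<close> of the binomials \<open>x\<^sup>a - x\<^sup>b\<close> that generate the ideal, in an order such that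
  the differences \<open>a - b\<close> are the generators of the lattice.\<close>

definition exponent_pairs :: "nat \<Rightarrow> ((nat \<Rightarrow>\<^sub>0 nat) \<times> (nat \<Rightarrow>\<^sub>0 nat)) set" where
  "exponent_pairs n =
    (\<lambda>i. (Poly_Mapping.single i 1, \<Sum>j \<in> {1..n} - {i}. Poly_Mapping.single j 1)) ` {1..n}
    \<union> {(Poly_Mapping.single n (2 * n - 4), 0)}
    \<union> (\<lambda>i. (Poly_Mapping.single i 2, Poly_Mapping.single n (2 * heaviside (int n - 3)))) ` {1..n - 1}"

lemma mvar_prod: "(\<Prod>j\<in>A. mvar j) = monomial (\<Sum>j\<in>A. Poly_Mapping.single j 1)"
  by (induction A rule: infinite_finite_induct) (simp_all add: mvar_def mult_single)

lemma keys_exponent_pairs: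
  assumes "n \<ge> 3" "(a, b) \<in> exponent_pairs n"
  shows "Poly_Mapping.keys a \<subseteq> {1..n}" "Poly_Mapping.keys b \<subseteq> {1..n}"
proof -
  have "Poly_Mapping.keys (\<Sum>j \<in> {1..n} - {i}. Poly_Mapping.single j (1 :: nat)) \<subseteq> {1..n}" for i
    by (rule order_trans[OF keys_sum]) auto
  with assms show "Poly_Mapping.keys a \<subseteq> {1..n}" "Poly_Mapping.keys b \<subseteq> {1..n}"
    by (auto simp: exponent_pairs_def split: if_splits)
qed

lemma lattice_gens_eq_exponent_pairs:
  assumes "n \<ge> 3"
  shows "lattice_gens n = (\<lambda>(a, b). int_exponent a - int_exponent b) ` exponent_pairs n"
proof -
  have "int_exponent (Poly_Mapping.single i 1) - int_exponent (\<Sum>j \<in> {1..n} - {i}. Poly_Mapping.single j 1)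
      = frag_cmul 2 (frag_of i) - (\<Sum>j = 1..n. frag_of j)" if "i \<in> {1..n}" for i
    using that unfolding int_exponent_sum int_exponent_single
    by (intro poly_mapping_eqI) (auto simp: lookup_minus lookup_sum_frag_of)
  moreover have "int_exponent (Poly_Mapping.single n (2 * n - 4)) = frag_cmul (2 * int n - 4) (frag_of n)"
    using assms by (simp add: int_exponent_single)
  ultimately show ?thesis
    unfolding lattice_gens_def exponent_pairs_def Setcompr_eq_image
    by (simp add: image_Un image_image int_exponent_single)
qed

lemma lattice_ideal_eq_exponent_pairs:
  "(lattice_ideal n :: 'a::field mpoly set) =
    Idl\<^bsub>mpoly_ring n\<^esub> ((\<lambda>(a, b). monomial a - monomial b) ` exponent_pairs n)"
  unfolding lattice_ideal_def exponent_pairs_def Setcompr_eq_image mvar_prod mvar_power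
  by (simp add: image_Un image_image mvar_def)

lemma exponent_pair_carrier:
  assumes "n \<ge> 3"
  shows "(\<lambda>(a, b). monomial a - monomial b :: 'a::field mpoly) ` exponent_pairs n \<subseteq> carrier (mpoly_ring n)"
proof -
  note R = ideal_mpoly_ringD(5)[OF ring.oneideal[OF cring.axioms(1)[OF cring_mpoly_ring]]]
  show ?thesis
  proof clarify
    fix a b assume "(a, b) \<in> exponent_pairs n"
    from R[OF single_in_mpoly_ring single_in_mpoly_ring] keys_exponent_pairs[OF assms this]
    show "monomial a - monomial b \<in> carrier (mpoly_ring n :: 'a mpoly ring)"
      by blast
  qed
qed

lemma ideal_lattice_ideal:
  assumes "n \<ge> 3"
  shows "ideal (lattice_ideal n :: 'a::field mpoly set) (mpoly_ring n)"
  unfolding lattice_ideal_eq_exponent_pairs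
  by (rule ring.genideal_ideal[OF cring.axioms(1)[OF cring_mpoly_ring] exponent_pair_carrier[OF assms]])

lemma exponent_pair_in_lattice_ideal:
  assumes "n \<ge> 3" "(a, b) \<in> exponent_pairs n"
  shows "monomial a - monomial b \<in> lattice_ideal n"
  unfolding lattice_ideal_eq_exponent_pairs
  using ring.genideal_self[OF cring.axioms(1)[OF cring_mpoly_ring] exponent_pair_carrier[OF assms(1)]]
    assms(2) by blast

lemma ideal_power_diff:
  assumes J: "ideal J (mpoly_ring n)" and ab: "a - b \<in> J"
    "a \<in> carrier (mpoly_ring n)" "b \<in> carrier (mpoly_ring n)"
  shows "a ^ k - b ^ k \<in> J"
proof -
  interpret R: cring "mpoly_ring n" by (rule cring_mpoly_ring)
  note JD = ideal_mpoly_ringD[OF J]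
  have bk: "b ^ k \<in> carrier (mpoly_ring n)" for k
  proof (induction k)
    case 0
    show ?case using R.one_closed by simp
  next
    case (Suc k)
    show ?case using R.m_closed[OF ab(3) Suc] by simp
  qed
  show ?thesis
  proof (induction k)
    case 0
    show ?case using JD(2) by simp
  next
    case (Suc k)
    from JD(3)[OF JD(4)[OF ab(2) Suc] JD(4)[OF bk[of k] ab(1)]]
    show ?case by (simp add: algebra_simps)
  qed
qed

text \<open>For \<open>i \<noteq> n\<close> let \<open>h\<close> be the value of the step function in the congruence of \<open>x\<^sub>i\<^sup>2\<close> and \<open>x\<^sub>n\<^sup>2\<^sup>h\<close>.
  Its power with exponent \<open>n - 2\<close> is a congruence of \<open>x\<^sub>i\<close> raised to \<open>2n - 4\<close> and \<open>x\<^sub>n\<close> raised to \<open>(2n - 4) h\<close>,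
  and the latter is \<open>1\<close> modulo the ideal both for \<open>h = 0\<close> and for \<open>h = 1\<close>.\<close>

lemma variable_power_minus_one_in_lattice_ideal:
  assumes n: "n \<ge> 3" and i: "i \<in> {1..n}"
  shows "mvar i ^ (2 * n - 4) - 1 \<in> lattice_ideal n"
proof (cases "i = n")
  case True
  have "(Poly_Mapping.single n (2 * n - 4), 0) \<in> exponent_pairs n"
    by (simp add: exponent_pairs_def)
  from exponent_pair_in_lattice_ideal[OF n this] show ?thesis
    by (simp add: mvar_power True)
next
  case False
  let ?h = "heaviside (int n - 3)"
  note I = ideal_lattice_ideal[OF n]
  have pair: "(Poly_Mapping.single m (2 * n - 4), 0) \<in> exponent_pairs n" if "m = n" for m
    using that by (simp add: exponent_pairs_def)
  have "(Poly_Mapping.single i 2, Poly_Mapping.single n (2 * ?h)) \<in> exponent_pairs n"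
    using i False by (auto simp: exponent_pairs_def)
  from exponent_pair_in_lattice_ideal[OF n this]
  have "mvar i ^ 2 - mvar n ^ (2 * ?h) \<in> lattice_ideal n"
    by (simp add: mvar_power)
  moreover have "mvar i ^ 2 \<in> carrier (mpoly_ring n)" "mvar n ^ (2 * ?h) \<in> carrier (mpoly_ring n)"
    unfolding mvar_power using i n by (auto intro!: single_in_mpoly_ring split: if_splits)
  ultimately have "(mvar i ^ 2) ^ (n - 2) - (mvar n ^ (2 * ?h)) ^ (n - 2) \<in> lattice_ideal n"
    by (rule ideal_power_diff[OF I])
  moreover have "2 * (n - 2) = 2 * n - 4" "2 * ?h * (n - 2) = (2 * n - 4) * ?h"
    by auto
  ultimately have diff: "mvar i ^ (2 * n - 4) - (mvar n ^ (2 * n - 4)) ^ ?h \<in> lattice_ideal n"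
    unfolding power_mult[symmetric] by simp
  have "mvar n ^ (2 * n - 4) - 1 \<in> lattice_ideal n"
    using exponent_pair_in_lattice_ideal[OF n pair] by (simp add: mvar_power)
  from ideal_mpoly_ringD(3)[OF I this diff] diff show ?thesis
    using n by (cases "n = 3") (simp_all add: heaviside_def)
qed

text \<open>An inverse of \<open>x\<^sub>i\<close> modulo the ideal is the power of \<open>x\<^sub>i\<close> with exponent \<open>2n - 5\<close>.\<close>

lemma monomial_unit_mod_lattice_ideal:
  assumes n: "n \<ge> 3" and m: "Poly_Mapping.keys m \<subseteq> {1..n}"
  shows "\<exists>q \<in> carrier (mpoly_ring n). q * monomial m - 1 \<in> (lattice_ideal n :: 'a::field mpoly set)"
proof -
  interpret R: cring "mpoly_ring n :: 'a mpoly ring" by (rule cring_mpoly_ring)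
  note ID = ideal_mpoly_ringD[OF ideal_lattice_ideal[OF n]]
  from m show ?thesis
  proof (rule monomial_induct)
    have "1 * 1 - 1 \<in> (lattice_ideal n :: 'a mpoly set)" using ID(2) by simp
    then show "\<exists>q \<in> carrier (mpoly_ring n). q * 1 - 1 \<in> (lattice_ideal n :: 'a mpoly set)"
      using R.one_closed by (intro bexI[of _ 1]) simp_all
  next
    fix p :: "'a mpoly" and i
    assume "\<exists>q \<in> carrier (mpoly_ring n). q * p - 1 \<in> lattice_ideal n" and i: "i \<in> {1..n}"
    then obtain q where q: "q \<in> carrier (mpoly_ring n)" "q * p - 1 \<in> lattice_ideal n" by blast
    have pow: "mvar i ^ k \<in> carrier (mpoly_ring n)" for k
      unfolding mvar_power using i by (intro single_in_mpoly_ring) auto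
    define k where "k = 2 * n - 5"
    have "Suc k = 2 * n - 4" using n by (simp add: k_def)
    then have "mvar i ^ Suc k - 1 \<in> (lattice_ideal n :: 'a mpoly set)"
      using variable_power_minus_one_in_lattice_ideal[OF n i] by (simp only:)
    from ID(3)[OF ID(4)[OF pow[of "Suc k"] q(2)] this]
    have "(mvar i ^ k * q) * (mvar i * p) - 1 \<in> lattice_ideal n"
      by (simp add: algebra_simps)
    moreover have "mvar i ^ k * q \<in> carrier (mpoly_ring n)"
      using R.m_closed[OF pow q(1)] by simp
    ultimately show "\<exists>q \<in> carrier (mpoly_ring n). q * (mvar i * p) - 1 \<in> lattice_ideal n" by blast
  qed
qed

text \<open>The exponent differences of all binomials in the ideal form a subgroup, which contains the
  generators of the lattice.  Hence \<open>a - b = c - d\<close> for some binomial \<open>x\<^sup>c - x\<^sup>d\<close> in the ideal.  Then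
  \<open>a + d = b + c\<close>, so \<open>x\<^sup>d (x\<^sup>a - x\<^sup>b) = x\<^sup>b (x\<^sup>c - x\<^sup>d)\<close> lies in the ideal, and \<open>x\<^sup>d\<close> cancels because it is a unit
  modulo the ideal.\<close>

lemma binomial_in_lattice_ideal:
  assumes n: "n \<ge> 3" and a: "Poly_Mapping.keys a \<subseteq> {1..n}" and b: "Poly_Mapping.keys b \<subseteq> {1..n}"
    and ab: "int_exponent a - int_exponent b \<in> lattice_L n"
  shows "monomial a - monomial b \<in> (lattice_ideal n :: 'a::field mpoly set)"
proof -
  interpret R: cring "mpoly_ring n :: 'a mpoly ring" by (rule cring_mpoly_ring)
  note ID = ideal_mpoly_ringD[OF ideal_lattice_ideal[OF n]]
  define D where "D = {int_exponent c - int_exponent d | c d.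
    Poly_Mapping.keys c \<subseteq> {1..n} \<and> Poly_Mapping.keys d \<subseteq> {1..n} \<and>
    monomial c - monomial d \<in> (lattice_ideal n :: 'a mpoly set)}"
  have DI: "int_exponent c - int_exponent d \<in> D"
    if "Poly_Mapping.keys c \<subseteq> {1..n}" "Poly_Mapping.keys d \<subseteq> {1..n}"
      "monomial c - monomial d \<in> (lattice_ideal n :: 'a mpoly set)" for c d
    using that by (auto simp: D_def)
  have "exponent_subgroup n D"
  proof (rule exponent_subgroup.intro, rule group.subgroupI[OF group_free_Abelian_group])
    show sub: "D \<subseteq> carrier (free_Abelian_group {1..n})"
      using keys_diff by (fastforce simp: D_def)
    show "D \<noteq> {}" using DI[of 0 0] ID(2) by auto
    fix x assume "x \<in> D"
    then obtain c d where cd: "x = int_exponent c - int_exponent d"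
      "Poly_Mapping.keys c \<subseteq> {1..n}" "Poly_Mapping.keys d \<subseteq> {1..n}"
      "monomial c - monomial d \<in> (lattice_ideal n :: 'a mpoly set)"
      by (auto simp: D_def)
    have "Poly_Mapping.keys x \<subseteq> {1..n}" using subsetD[OF sub \<open>x \<in> D\<close>] by simp
    moreover have "int_exponent d - int_exponent c \<in> D"
      using ID(5)[OF ID(2) cd(4)] cd by (intro DI) simp_all
    ultimately show "inv\<^bsub>free_Abelian_group {1..n}\<^esub> x \<in> D" using cd(1) by simp
    fix y assume "y \<in> D"
    then obtain c' d' where cd': "y = int_exponent c' - int_exponent d'"
      "Poly_Mapping.keys c' \<subseteq> {1..n}" "Poly_Mapping.keys d' \<subseteq> {1..n}"
      "monomial c' - monomial d' \<in> (lattice_ideal n :: 'a mpoly set)"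
      by (auto simp: D_def)
    have "monomial c * (monomial c' - monomial d') + monomial d' * (monomial c - monomial d)
        \<in> (lattice_ideal n :: 'a mpoly set)"
      by (intro ID(3) ID(4) single_in_mpoly_ring cd cd')
    then have "monomial (c + c') - monomial (d + d') \<in> (lattice_ideal n :: 'a mpoly set)"
      by (simp add: algebra_simps mult_single)
    moreover have "Poly_Mapping.keys (c + c') \<subseteq> {1..n}" "Poly_Mapping.keys (d + d') \<subseteq> {1..n}"
      using keys_add[of c c'] keys_add[of d d'] cd cd' by blast+
    ultimately have "int_exponent (c + c') - int_exponent (d + d') \<in> D"
      by (intro DI)
    then show "x \<otimes>\<^bsub>free_Abelian_group {1..n}\<^esub> y \<in> D"
      unfolding mult_free_Abelian_group cd(1) cd'(1) by (simp only: int_exponent_simps add_diff_add)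
  qed
  moreover have "lattice_gens n \<subseteq> D"
    unfolding lattice_gens_eq_exponent_pairs[OF n]
  proof clarify
    fix c d assume "(c, d) \<in> exponent_pairs n"
    then show "int_exponent c - int_exponent d \<in> D"
      by (intro DI keys_exponent_pairs[OF n] exponent_pair_in_lattice_ideal[OF n])
  qed
  ultimately have "int_exponent a - int_exponent b \<in> D"
    using lattice_L_subset ab by blast
  then obtain c d where cd: "int_exponent a - int_exponent b = int_exponent c - int_exponent d"
    "Poly_Mapping.keys c \<subseteq> {1..n}" "Poly_Mapping.keys d \<subseteq> {1..n}"
    "monomial c - monomial d \<in> (lattice_ideal n :: 'a mpoly set)"
    by (auto simp: D_def)
  have "int_exponent (a + d) = int_exponent (b + c)"
    using cd(1) by (simp add: algebra_simps)
  then have "a + d = b + c"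
    by (metis lookup_int_exponent of_nat_eq_iff poly_mapping_eqI)
  then have "monomial d * (monomial a - monomial b) = monomial b * (monomial c - monomial d :: 'a mpoly)"
    by (simp add: algebra_simps mult_single)
  then have di: "monomial d * (monomial a - monomial b) \<in> (lattice_ideal n :: 'a mpoly set)"
    using ID(4)[OF single_in_mpoly_ring[OF b] cd(4)] by simp
  obtain q where q: "q \<in> carrier (mpoly_ring n)" "q * monomial d - 1 \<in> (lattice_ideal n :: 'a mpoly set)"
    using monomial_unit_mod_lattice_ideal[OF n cd(3)] by blast
  have "monomial a - monomial b \<in> carrier (mpoly_ring n :: 'a mpoly ring)"
    using ideal_mpoly_ringD(5)[OF R.oneideal] single_in_mpoly_ring a b by blast
  from ID(5)[OF ID(4)[OF q(1) di] ID(4)[OF this q(2)]]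
  show ?thesis by (simp add: algebra_simps)
qed

section \<open>The isomorphism and the colength\<close>

abbreviation lattice_projection :: "nat \<Rightarrow> 'a::field mpoly \<Rightarrow> ((nat \<Rightarrow>\<^sub>0 int) set \<Rightarrow>\<^sub>0 'a)" where
  "lattice_projection n \<equiv> push_forward (\<lambda>m. lattice_class n (int_exponent m))"

lemma lattice_projection_ring_hom:
  assumes n: "n \<ge> 3"
  shows "lattice_projection n \<in> ring_hom (mpoly_ring n :: 'a::field mpoly ring) (group_algebra (lattice_quotient n))"
proof (rule ring_hom_memI)
  fix p :: "'a mpoly" assume p: "p \<in> carrier (mpoly_ring n)"
  then show "lattice_projection n p \<in> carrier (group_algebra (lattice_quotient n))"
    using keys_push_forward[of "\<lambda>m. lattice_class n (int_exponent m)" p]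
    by (fastforce simp: carrier_mpoly_ring carrier_lattice_quotient)
  fix q :: "'a mpoly" assume q: "q \<in> carrier (mpoly_ring n)"
  have "lattice_projection n (p * q) =
      lattice_projection n p \<otimes>\<^bsub>group_algebra (lattice_quotient n)\<^esub> lattice_projection n q"
  proof (rule push_forward_mult)
    fix k l assume "k \<in> Poly_Mapping.keys p" "l \<in> Poly_Mapping.keys q"
    then show "lattice_class n (int_exponent (k + l)) =
        lattice_class n (int_exponent k) \<otimes>\<^bsub>lattice_quotient n\<^esub> lattice_class n (int_exponent l)"
      using p q by (simp add: lattice_class_mult[OF n] carrier_mpoly_ring)
  qed
  then show "lattice_projection n (p \<otimes>\<^bsub>mpoly_ring n\<^esub> q) =
      lattice_projection n p \<otimes>\<^bsub>group_algebra (lattice_quotient n)\<^esub> lattice_projection n q"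
    by simp
  show "lattice_projection n (p \<oplus>\<^bsub>mpoly_ring n\<^esub> q) =
      lattice_projection n p \<oplus>\<^bsub>group_algebra (lattice_quotient n)\<^esub> lattice_projection n q"
    by (simp add: push_forward_add)
next
  have "lattice_projection n (Poly_Mapping.single 0 1 :: 'a mpoly) = \<one>\<^bsub>group_algebra (lattice_quotient n)\<^esub>"
    unfolding push_forward_single by (simp add: one_lattice_quotient[OF n])
  then show "lattice_projection n (\<one>\<^bsub>mpoly_ring n\<^esub> :: 'a mpoly) = \<one>\<^bsub>group_algebra (lattice_quotient n)\<^esub>"
    by simp
qed

lemma lattice_ideal_subset_kernel:
  assumes n: "n \<ge> 3" and p: "p \<in> (lattice_ideal n :: 'a::field mpoly set)"
  shows "lattice_projection n p = 0"
proof -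
  interpret \<pi>: Vector_Spaces.linear "\<lambda>c p. mconst c * p" scalar_mult
      "lattice_projection n :: 'a mpoly \<Rightarrow> _"
    by (rule linear_push_forward)
  let ?P = "carrier (mpoly_ring n :: 'a mpoly ring)"
  have ring: "ring (mpoly_ring n :: 'a mpoly ring)"
    by (rule cring.axioms(1)[OF cring_mpoly_ring])
  note PD = ideal_mpoly_ringD[OF ring.oneideal[OF ring]]
  have "ideal {p \<in> ?P. lattice_projection n p = 0} (mpoly_ring n)"
  proof (rule ideal_mpoly_ringI)
    fix p q assume "p \<in> ?P" "q \<in> {p \<in> ?P. lattice_projection n p = 0}"
    then show "p * q \<in> {p \<in> ?P. lattice_projection n p = 0}"
      using PD(4) ring_hom_mult[OF lattice_projection_ring_hom[OF n], of p q] by simp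
  qed (use PD(2,3) in \<open>simp_all add: push_forward_add\<close>)
  moreover have "(\<lambda>(a, b). monomial a - monomial b) ` exponent_pairs n \<subseteq>
      {p \<in> ?P. lattice_projection n p = 0}"
  proof clarify
    fix a b assume ab: "(a, b) \<in> exponent_pairs n"
    have "int_exponent a - int_exponent b \<in> lattice_L n"
      using lattice_gens_subset_L[of n] ab unfolding lattice_gens_eq_exponent_pairs[OF n] by blast
    then have "lattice_class n (int_exponent a) = lattice_class n (int_exponent b)"
      using lattice_class_eq_iff[OF n] keys_exponent_pairs[OF n ab] by simp
    then have "lattice_projection n (monomial a - monomial b :: 'a mpoly) = 0"
      by (simp add: \<pi>.diff)
    moreover have "monomial a - monomial b \<in> ?P"
      using exponent_pair_carrier[OF n] ab by blast
    ultimately show "monomial a - monomial b \<in> ?P \<and> lattice_projection n (monomial a - monomial b :: 'a mpoly) = 0"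
      by blast
  qed
  ultimately have "lattice_ideal n \<subseteq> {p \<in> ?P. lattice_projection n p = 0}"
    unfolding lattice_ideal_eq_exponent_pairs by (rule ring.genideal_minimal[OF ring])
  with p show ?thesis by blast
qed

text \<open>Choosing a monomial in each class gives a linear map \<open>\<sigma>\<close> back to the polynomials.  Every monomial
  is congruent to the chosen monomial of its class, so \<open>p\<close> is congruent to \<open>\<sigma> (\<pi> p)\<close> modulo the ideal,
  where \<open>\<pi>\<close> is the projection.  If \<open>\<pi> p = 0\<close>, this says that \<open>p\<close> lies in the ideal.\<close>

lemma kernel_subset_lattice_ideal:
  assumes n: "n \<ge> 3" and p: "p \<in> carrier (mpoly_ring n :: 'a::field mpoly ring)"
    and zero: "lattice_projection n p = 0"
  shows "p \<in> lattice_ideal n"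
proof -
  note ID = ideal_mpoly_ringD[OF ideal_lattice_ideal[OF n]]
  define rep where "rep g = (SOME m. Poly_Mapping.keys m \<subseteq> {1..n} \<and> lattice_class n (int_exponent m) = g)" for g
  have "p - push_forward rep (lattice_projection n p) \<in> lattice_ideal n"
  proof (rule poly_mapping_additive_induct[of p])
    fix m and c :: 'a
    assume "m \<in> Poly_Mapping.keys p"
    then have m: "Poly_Mapping.keys m \<subseteq> {1..n}" using p by (simp add: carrier_mpoly_ring)
    define r where "r = rep (lattice_class n (int_exponent m))"
    have "Poly_Mapping.keys r \<subseteq> {1..n} \<and> lattice_class n (int_exponent r) = lattice_class n (int_exponent m)"
      unfolding r_def rep_def by (rule someI[of _ m]) (use m in simp)
    then have "monomial m - monomial r \<in> (lattice_ideal n :: 'a mpoly set)"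
      using m lattice_class_eq_iff[OF n, of "int_exponent m" "int_exponent r"]
      by (intro binomial_in_lattice_ideal[OF n]) auto
    from ID(4)[OF mconst_in_mpoly_ring[of c] this]
    show "Poly_Mapping.single m c - push_forward rep (lattice_projection n (Poly_Mapping.single m c))
        \<in> lattice_ideal n"
      by (simp add: r_def mconst_def mult_single right_diff_distrib)
  next
    show "0 - push_forward rep (lattice_projection n 0) \<in> (lattice_ideal n :: 'a mpoly set)"
      using ID(2) by simp
  next
    fix p q :: "'a mpoly"
    assume "p - push_forward rep (lattice_projection n p) \<in> lattice_ideal n"
      "q - push_forward rep (lattice_projection n q) \<in> lattice_ideal n"
    from ID(3)[OF this]
    show "p + q - push_forward rep (lattice_projection n (p + q)) \<in> lattice_ideal n"
      by (simp add: push_forward_add algebra_simps)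
  qed
  then show ?thesis by (simp add: zero)
qed

lemma group_algebra_lattice_quotient_span:
  assumes n: "n \<ge> 3"
  defines "B \<equiv> (\<lambda>g. Poly_Mapping.single g (1 :: 'a::field)) ` carrier (lattice_quotient n)"
  shows "lattice_projection n ` carrier (mpoly_ring n) = module.span scalar_mult B"
    and "carrier (group_algebra (lattice_quotient n)) = module.span scalar_mult B"
proof -
  interpret \<pi>: Vector_Spaces.linear "\<lambda>c p. mconst c * p" scalar_mult
      "lattice_projection n :: 'a mpoly \<Rightarrow> _"
    by (rule linear_push_forward)
  show A: "carrier (group_algebra (lattice_quotient n)) = \<pi>.vs2.span B"
    by (simp add: B_def group_algebra_basis(2)[OF finite_lattice_quotient[OF n]])
  show "lattice_projection n ` carrier (mpoly_ring n) = \<pi>.vs2.span B"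
  proof (rule antisym)
    show "lattice_projection n ` carrier (mpoly_ring n) \<subseteq> \<pi>.vs2.span B"
      unfolding A[symmetric] using ring_hom_closed[OF lattice_projection_ring_hom[OF n]] by blast
    note PD = ideal_mpoly_ringD[OF ring.oneideal[OF cring.axioms(1)[OF cring_mpoly_ring]]]
    have "\<pi>.vs1.subspace (carrier (mpoly_ring n))"
      by (intro \<pi>.vs1.subspaceI PD(2) PD(3) PD(4) mconst_in_mpoly_ring)
    then have "\<pi>.vs2.subspace (lattice_projection n ` carrier (mpoly_ring n))"
      by (rule \<pi>.subspace_image)
    moreover have "B \<subseteq> lattice_projection n ` carrier (mpoly_ring n)"
    proof
      fix b assume "b \<in> B"
      then obtain d where d: "Poly_Mapping.keys d \<subseteq> {1..n}"
          "b = Poly_Mapping.single (lattice_class n d) 1"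
        by (auto simp: B_def carrier_lattice_quotient)
      obtain m where m: "Poly_Mapping.keys m \<subseteq> {1..n}" "lattice_class n (int_exponent m) = lattice_class n d"
        using lattice_class_reduced_exponent[OF n d(1)] by blast
      then have "b = lattice_projection n (monomial m)"
        using d(2) by simp
      with single_in_mpoly_ring[OF m(1)] show "b \<in> lattice_projection n ` carrier (mpoly_ring n)"
        by blast
    qed
    ultimately show "\<pi>.vs2.span B \<subseteq> lattice_projection n ` carrier (mpoly_ring n)"
      by (intro \<pi>.vs2.span_minimal)
  qed
qed

theorem lattice_algebra_iso:
  assumes n: "n \<ge> 3"
  shows "\<exists>\<phi> \<in> algebra_iso (quotient_algebra n (lattice_ideal n :: 'a::field mpoly set))
      (group_algebra (lattice_quotient n)).
    \<forall>p \<in> carrier (mpoly_ring n). \<phi> (lattice_ideal n +>\<^bsub>mpoly_ring n\<^esub> p) = lattice_projection n p"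
proof -
  let ?R = "mpoly_ring n :: 'a mpoly ring" and ?A = "group_algebra (lattice_quotient n) :: ('a, _) module"
  let ?I = "lattice_ideal n :: 'a mpoly set"
  interpret R: cring ?R by (rule cring_mpoly_ring)
  interpret \<pi>: Vector_Spaces.linear "\<lambda>c p. mconst c * p" scalar_mult
      "lattice_projection n :: 'a mpoly \<Rightarrow> _"
    by (rule linear_push_forward)
  interpret I: ideal ?I ?R by (rule ideal_lattice_ideal[OF n])
  have img: "lattice_projection n ` carrier ?R = carrier ?A"
    unfolding group_algebra_lattice_quotient_span[OF n] ..
  \<comment> \<open>The ring axioms of the group algebra are inherited from the polynomial ring, because the
    projection is multiplicative and onto.\<close>
  have "ring (?A \<lparr>carrier := lattice_projection n ` carrier ?R, zero := lattice_projection n \<zero>\<^bsub>?R\<^esub>\<rparr>)"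
    by (rule R.ring_hom_imp_img_ring[OF lattice_projection_ring_hom[OF n]])
  also have "?A \<lparr>carrier := lattice_projection n ` carrier ?R, zero := lattice_projection n \<zero>\<^bsub>?R\<^esub>\<rparr> = ?A"
    unfolding img by (simp add: group_algebra_def)
  finally have "ring ?A" .
  then have hom: "ring_hom_ring ?R ?A (lattice_projection n)"
    by (rule ring_hom_ringI2[OF R.ring_axioms _ lattice_projection_ring_hom[OF n]])
  have ker: "a_kernel ?R ?A (lattice_projection n) = ?I"
    using lattice_ideal_subset_kernel[OF n] kernel_subset_lattice_ideal[OF n] I.a_subset
    by (auto simp: a_kernel_def')
  define \<phi> where "\<phi> c = the_elem (lattice_projection n ` c)" for c :: "'a mpoly set"
  have iso: "\<phi> \<in> ring_iso (?R Quot ?I) ?A"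
    using ring_hom_ring.FactRing_iso_set[OF hom img] unfolding ker \<phi>_def .
  have val: "\<phi> (?I +>\<^bsub>?R\<^esub> p) = lattice_projection n p" if "p \<in> carrier ?R" for p
    using ring_hom_ring.the_elem_simp[OF hom, unfolded ker, OF that] unfolding ker \<phi>_def .
  have "\<phi> \<in> algebra_iso (quotient_algebra n ?I) ?A"
    unfolding algebra_iso_def
  proof (intro CollectI conjI allI ballI)
    show "\<phi> \<in> ring_iso (quotient_algebra n ?I) ?A"
      using iso by (simp add: ring_iso_def ring_hom_def quotient_algebra_def algebra_via_def)
  next
    fix c x assume "x \<in> carrier (quotient_algebra n ?I)"
    then obtain p where p: "p \<in> carrier ?R" "x = ?I +>\<^bsub>?R\<^esub> p"
      by (auto simp: quotient_algebra_def algebra_via_def FactRing_def A_RCOSETS_def')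
    have "c \<odot>\<^bsub>quotient_algebra n ?I\<^esub> x = ?I +>\<^bsub>?R\<^esub> (mconst c * p)"
      using I.rcoset_mult_add[OF mconst_in_mpoly_ring p(1), of c] p(2)
      by (simp add: quotient_algebra_def algebra_via_def FactRing_def)
    moreover have "mconst c * p \<in> carrier ?R"
      using R.m_closed[OF mconst_in_mpoly_ring p(1)] by simp
    ultimately show "\<phi> (c \<odot>\<^bsub>quotient_algebra n ?I\<^esub> x) = c \<odot>\<^bsub>?A\<^esub> \<phi> x"
      using p val by (simp add: \<pi>.scale)
  qed
  with val show ?thesis by blast
qed

theorem colength_lattice_ideal:
  assumes n: "n \<ge> 3"
  shows "colength (mpoly_ring n) (lattice_ideal n :: 'a::alg_closed_field mpoly set)
    = enat (Coset.order (lattice_quotient n))"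
proof -
  let ?B = "(\<lambda>g. Poly_Mapping.single g (1 :: 'a)) ` carrier (lattice_quotient n)"
  note basis = group_algebra_basis[OF finite_lattice_quotient[OF n], where 'a = 'a]
  have "colength (mpoly_ring n) (lattice_ideal n :: 'a mpoly set) = enat (card ?B)"
  proof (rule colength_eq_card_basis)
    fix i assume i: "i \<in> {1..n}"
    \<comment> \<open>Modulo the ideal, every variable is a root of unity of order dividing \<open>2n - 4\<close>.\<close>
    let ?f = "Polynomial.monom 1 (2 * n - 4) - 1 :: 'a poly"
    have "coeff ?f (2 * n - 4) \<noteq> 0" using n by simp
    then have "?f \<noteq> 0" by (rule contrapos_nn) (simp only: coeff_0)
    moreover have "map_poly mconst ?f = Polynomial.monom 1 (2 * n - 4) - 1"
      by (rule poly_eqI) (simp add: coeff_map_poly mconst_def single_diff)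
    then have "poly_at ?f (mvar i) \<in> lattice_ideal n"
      using variable_power_minus_one_in_lattice_ideal[OF n i] by (simp add: poly_monom)
    ultimately show "\<exists>f. f \<noteq> 0 \<and> poly_at f (mvar i) \<in> (lattice_ideal n :: 'a mpoly set)"
      by blast
  next
    fix p :: "'a mpoly" assume "p \<in> carrier (mpoly_ring n)"
    then show "lattice_projection n p = 0 \<longleftrightarrow> p \<in> lattice_ideal n"
      using lattice_ideal_subset_kernel[OF n] kernel_subset_lattice_ideal[OF n] by blast
  qed (rule ideal_lattice_ideal[OF n] linear_push_forward basis(3) basis(1)
      group_algebra_lattice_quotient_span(1)[OF n])+
  then show ?thesis by (simp add: basis(4) Coset.order_def)
qed

section \<open>The presented group\<close>

definition word_exponent :: "nat word \<Rightarrow> (nat \<Rightarrow>\<^sub>0 int)" where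
  "word_exponent w = (\<Sum>(i, b) \<leftarrow> w. if b then frag_of i else - frag_of i)"

lemma word_exponent_simps [simp]:
  "word_exponent [] = 0" "word_exponent (u @ v) = word_exponent u + word_exponent v"
  "word_exponent ((i, b) # w) = (if b then frag_of i else - frag_of i) + word_exponent w"
  by (simp_all add: word_exponent_def)

lemma keys_word_exponent:
  "w \<in> lists ({1..n} \<times> UNIV) \<Longrightarrow> Poly_Mapping.keys (word_exponent w) \<subseteq> {1..n}"
proof (induction w)
  case (Cons a w)
  obtain i b where a: "a = (i, b)" by (cases a)
  have "Poly_Mapping.keys ((if b then frag_of i else - frag_of i) + word_exponent w)
      \<subseteq> insert i (Poly_Mapping.keys (word_exponent w))"
    by (rule order_trans[OF keys_add]) auto
  with Cons a show ?case by auto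
qed simp

definition relations_G :: "nat \<Rightarrow> (nat word \<times> nat word) set" where
  "relations_G n = {([(i, True), (j, True)], [(j, True), (i, True)]) | i j. i \<in> {1..n} \<and> j \<in> {1..n}}
    \<union> {(map (\<lambda>j. (j, True)) (filter (\<lambda>j. j \<noteq> k) [1..<Suc n]), [(k, True)]) | k. k \<in> {1..n}}"

abbreviation cong_G :: "nat \<Rightarrow> (nat word \<times> nat word) set" where
  "cong_G n \<equiv> word_cong {1..n} (relations_G n)"

lemma word_exponent_relation:
  assumes "k \<in> {1..n}"
  shows "word_exponent [(k, True)] - word_exponent (map (\<lambda>j. (j, True)) (filter (\<lambda>j. j \<noteq> k) [1..<Suc n]))
    = frag_cmul 2 (frag_of k) - (\<Sum>j = 1..n. frag_of j)"
proof -
  have "word_exponent (map (\<lambda>j. (j, True)) (filter (\<lambda>j. j \<noteq> k) [1..<Suc n]))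
      = (\<Sum>j \<leftarrow> filter (\<lambda>j. j \<noteq> k) [1..<Suc n]. frag_of j)"
    by (simp add: word_exponent_def comp_def del: upt_Suc)
  also have "\<dots> = (\<Sum>j \<in> {1..n} - {k}. frag_of j)"
    by (subst sum_list_distinct_conv_sum_set) (auto intro!: sum.cong)
  finally show ?thesis
    using assms by (intro poly_mapping_eqI) (auto simp: lookup_minus lookup_sum_frag_of)
qed

lemma word_exponent_diff_in_lattice:
  assumes n: "n \<ge> 3" and uv: "(u, v) \<in> cong_G n"
  shows "word_exponent u - word_exponent v \<in> lattice_L n"
proof -
  interpret L: exponent_subgroup n "lattice_L n"
    by (rule exponent_subgroup_lattice_L[OF n])
  from uv show ?thesis
  proof (induction rule: word_cong.induct)
    case (refl w)
    show ?case by (simp add: L.zero)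
  next
    case (sym u v)
    then show ?case using L.uminus[of "word_exponent u - word_exponent v"] by simp
  next
    case (trans u v w)
    then show ?case
      using L.add[of "word_exponent u - word_exponent v" "word_exponent v - word_exponent w"] by simp
  next
    case (append u u' v v')
    then show ?case
      using L.add[of "word_exponent u - word_exponent u'" "word_exponent v - word_exponent v'"]
      by (simp add: add_diff_add)
  next
    case (cancel g b)
    show ?case by (simp add: L.zero)
  next
    case (relation u v)
    from relation(1)[unfolded relations_G_def] consider
      (comm) i j where "u = [(i, True), (j, True)]" "v = [(j, True), (i, True)]"
      | (prod) k where "k \<in> {1..n}" "u = map (\<lambda>j. (j, True)) (filter (\<lambda>j. j \<noteq> k) [1..<Suc n])"
          "v = [(k, True)]"
      by blast
    then show ?case
    proof cases
      case comm
      then show ?thesis by (simp add: L.zero)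
    next
      case prod
      have "word_exponent v - word_exponent u \<in> lattice_L n"
        unfolding prod(2,3) word_exponent_relation[OF prod(1)]
        using lattice_gens_subset_L[of n] prod(1) by (auto simp: lattice_gens_def)
      from L.uminus[OF this] show ?thesis by simp
    qed
  qed
qed

lemma G_group_eq: "G_group n = presented_group {1..n} (relations_G n)"
  by (simp only: G_group_def relations_G_def)

definition class_G :: "nat \<Rightarrow> nat word \<Rightarrow> nat word set" where
  "class_G n w = cong_G n `` {w}"

lemma class_G_eq_iff:
  assumes "u \<in> lists ({1..n} \<times> UNIV)" "v \<in> lists ({1..n} \<times> UNIV)"
  shows "class_G n u = class_G n v \<longleftrightarrow> (u, v) \<in> cong_G n"
  unfolding class_G_def using eq_equiv_class_iff[OF equiv_word_cong assms] .

lemma class_G_eqI: "(u, v) \<in> cong_G n \<Longrightarrow> class_G n u = class_G n v"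
  unfolding class_G_def by (rule equiv_class_eq[OF equiv_word_cong])

lemma class_G_Nil: "class_G n [] = \<one>\<^bsub>G_group n\<^esub>"
  by (simp add: G_group_eq presented_group_def class_G_def)

lemma carrier_G_group: "carrier (G_group n) = class_G n ` lists ({1..n} \<times> UNIV)"
  by (auto simp: G_group_eq presented_group_def quotient_def class_G_def)

lemma class_G_append:
  assumes "u \<in> lists ({1..n} \<times> UNIV)" "v \<in> lists ({1..n} \<times> UNIV)"
  shows "class_G n (u @ v) = class_G n u \<otimes>\<^bsub>G_group n\<^esub> class_G n v"
  unfolding G_group_eq class_G_def by (rule presented_group_mult[OF assms, symmetric])

lemma class_G_inverse:
  assumes "i \<in> {1..n}"
  shows "class_G n [(i, False)] = inv\<^bsub>G_group n\<^esub> class_G n [(i, True)]"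
proof -
  have group: "group (G_group n)" unfolding G_group_eq by (rule group_presented_group)
  have w: "[(i, b)] \<in> lists ({1..n} \<times> UNIV)" for b :: bool using assms by simp
  have "class_G n [(i, False)] \<otimes>\<^bsub>G_group n\<^esub> class_G n [(i, True)] = class_G n ([(i, False)] @ [(i, True)])"
    by (rule class_G_append[OF w w, symmetric])
  also have "\<dots> = class_G n []"
    using word_cong.cancel[OF assms, of False] by (intro class_G_eqI) simp
  also have "\<dots> = \<one>\<^bsub>G_group n\<^esub>" by (rule class_G_Nil)
  finally have "class_G n [(i, False)] \<otimes>\<^bsub>G_group n\<^esub> class_G n [(i, True)] = \<one>\<^bsub>G_group n\<^esub>" .
  then show ?thesis
    using w carrier_G_group by (intro group.inv_equality[OF group, symmetric]) blast+
qed

lemma (in group) inv_commute: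
  assumes "g \<in> carrier G" "x \<in> carrier G" "g \<otimes> x = x \<otimes> g"
  shows "inv g \<otimes> x = x \<otimes> inv g"
proof -
  have "g \<otimes> (x \<otimes> inv g) = (x \<otimes> g) \<otimes> inv g"
    using assms by (simp flip: m_assoc)
  also have "\<dots> = x" using assms by (simp add: m_assoc)
  finally show ?thesis
    using assms inv_solve_left[of "x \<otimes> inv g" g x] by simp
qed

text \<open>An element that commutes with the generators also commutes with their inverses and so with the
  class of every word.  This is used twice: the generators commute with each other, hence every
  element commutes with the generators, hence with every element.\<close>

lemma comm_group_G_group: "comm_group (G_group n)"
proof -
  interpret G: group "G_group n" unfolding G_group_eq by (rule group_presented_group)
  have car: "class_G n w \<in> carrier (G_group n)" if "w \<in> lists ({1..n} \<times> UNIV)" for w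
    using that carrier_G_group by blast
  have central: "class_G n w \<otimes>\<^bsub>G_group n\<^esub> x = x \<otimes>\<^bsub>G_group n\<^esub> class_G n w"
    if x: "x \<in> carrier (G_group n)"
      and comm: "\<And>i. i \<in> {1..n} \<Longrightarrow> class_G n [(i, True)] \<otimes>\<^bsub>G_group n\<^esub> x = x \<otimes>\<^bsub>G_group n\<^esub> class_G n [(i, True)]"
      and w: "w \<in> lists ({1..n} \<times> UNIV)" for x w
    using w
  proof (induction w)
    case Nil
    show ?case using x by (simp add: class_G_Nil)
  next
    case (Cons a w)
    obtain i b where a: "a = (i, b)" by (cases a)
    have i: "i \<in> {1..n}" and w: "w \<in> lists ({1..n} \<times> UNIV)" using Cons a by auto
    have g: "[(i, c)] \<in> lists ({1..n} \<times> UNIV)" for c :: bool using i by simp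
    have "class_G n [(i, b)] \<otimes>\<^bsub>G_group n\<^esub> x = x \<otimes>\<^bsub>G_group n\<^esub> class_G n [(i, b)]"
    proof (cases b)
      case False
      then show ?thesis
        using G.inv_commute[OF car[OF g] x comm[OF i]] class_G_inverse[OF i] by simp
    qed (use comm[OF i] in simp)
    then have "(class_G n [(i, b)] \<otimes>\<^bsub>G_group n\<^esub> class_G n w) \<otimes>\<^bsub>G_group n\<^esub> x =
        x \<otimes>\<^bsub>G_group n\<^esub> (class_G n [(i, b)] \<otimes>\<^bsub>G_group n\<^esub> class_G n w)"
      unfolding G.m_assoc[OF car[OF g[of b]] car[OF w] x] Cons.IH
        G.m_assoc[OF car[OF g[of b]] x car[OF w], symmetric]
      by (simp only: G.m_assoc[OF x car[OF g[of b]] car[OF w]])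
    moreover have "class_G n (a # w) = class_G n [(i, b)] \<otimes>\<^bsub>G_group n\<^esub> class_G n w"
      using class_G_append[OF g w] a by simp
    ultimately show ?case by (simp only:)
  qed
  show ?thesis
  proof (rule group.group_comm_groupI[OF G.group_axioms])
    fix x y assume "x \<in> carrier (G_group n)" "y \<in> carrier (G_group n)"
    then obtain u v where uv: "u \<in> lists ({1..n} \<times> UNIV)" "x = class_G n u"
        "v \<in> lists ({1..n} \<times> UNIV)" "y = class_G n v"
      unfolding carrier_G_group by blast
    have gen: "class_G n [(i, True)] \<otimes>\<^bsub>G_group n\<^esub> class_G n [(j, True)] =
        class_G n [(j, True)] \<otimes>\<^bsub>G_group n\<^esub> class_G n [(i, True)]"
      if ij: "i \<in> {1..n}" "j \<in> {1..n}" for i j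
    proof -
      have w: "[(i, True)] \<in> lists ({1..n} \<times> UNIV)" "[(j, True)] \<in> lists ({1..n} \<times> UNIV)"
        using ij by simp_all
      have "([(i, True), (j, True)], [(j, True), (i, True)]) \<in> cong_G n"
        by (rule word_cong.relation) (use ij in \<open>auto simp: relations_G_def\<close>)
      then have "class_G n [(i, True), (j, True)] = class_G n [(j, True), (i, True)]"
        by (rule class_G_eqI)
      then show ?thesis
        unfolding class_G_append[OF w, symmetric] class_G_append[OF w(2,1), symmetric] by simp
    qed
    have "class_G n v \<otimes>\<^bsub>G_group n\<^esub> class_G n [(i, True)] = class_G n [(i, True)] \<otimes>\<^bsub>G_group n\<^esub> class_G n v"
      if "i \<in> {1..n}" for i
    proof (rule central[OF _ _ uv(3)])
      show "class_G n [(i, True)] \<in> carrier (G_group n)"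
        using that by (intro car) simp
    qed (rule gen[OF _ that])
    from central[OF car[OF uv(3)] this[symmetric] uv(1)]
    show "x \<otimes>\<^bsub>G_group n\<^esub> y = y \<otimes>\<^bsub>G_group n\<^esub> x"
      unfolding uv .
  qed
qed

lemma word_exponent_surj:
  assumes "Poly_Mapping.keys d \<subseteq> {1..n}"
  shows "\<exists>w \<in> lists ({1..n} \<times> UNIV). word_exponent w = d"
  using assms
proof (rule free_Abelian_group_induct)
  show "\<exists>w \<in> lists ({1..n} \<times> UNIV). word_exponent w = 0"
    by (intro bexI[of _ "[]"]) simp_all
  show "\<exists>w \<in> lists ({1..n} \<times> UNIV). word_exponent w = frag_of i" if "i \<in> {1..n}" for i
    using that by (intro bexI[of _ "[(i, True)]"]) simp_all
  fix d e :: "nat \<Rightarrow>\<^sub>0 int"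
  assume "\<exists>w \<in> lists ({1..n} \<times> UNIV). word_exponent w = d"
    and "\<exists>w \<in> lists ({1..n} \<times> UNIV). word_exponent w = e"
  then obtain u v where uv: "u \<in> lists ({1..n} \<times> UNIV)" "word_exponent u = d"
    "v \<in> lists ({1..n} \<times> UNIV)" "word_exponent v = e" by blast
  let ?v = "map (\<lambda>(i, b). (i, \<not> b)) v"
  have "word_exponent ?v = - word_exponent v"
    by (induction v) auto
  moreover have "?v \<in> lists ({1..n} \<times> UNIV)"
    using uv(3) by (induction v) auto
  ultimately show "\<exists>w \<in> lists ({1..n} \<times> UNIV). word_exponent w = d - e"
    using uv by (intro bexI[of _ "u @ ?v"]) simp_all
qed

text \<open>The relations of \<open>G\<^sub>n\<close> hold in the quotient of \<open>\<int>\<^sup>n\<close> by the lattice, so congruent words have the same class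
  there.  Conversely, \<open>G\<^sub>n\<close> is abelian, so \<open>e\<^sub>i \<mapsto> g\<^sub>i\<close> extends to a homomorphism on \<open>\<int>\<^sup>n\<close>, which
  takes the exponent of a word to the class of the word.  It annihilates \<open>2 e\<^sub>k - s\<close>, where \<open>s\<close> is
  the sum of all \<open>e\<^sub>j\<close>, because \<open>g\<^sub>k\<close> is the product of the other generators.  These vectors generate the
  lattice, so the homomorphism annihilates the lattice.\<close>

lemma cong_G_iff:
  assumes n: "n \<ge> 3" and u: "u \<in> lists ({1..n} \<times> UNIV)" and v: "v \<in> lists ({1..n} \<times> UNIV)"
  shows "(u, v) \<in> cong_G n \<longleftrightarrow> lattice_class n (word_exponent u) = lattice_class n (word_exponent v)"
proof
  assume "(u, v) \<in> cong_G n"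
  then show "lattice_class n (word_exponent u) = lattice_class n (word_exponent v)"
    using lattice_class_eq_iff[OF n keys_word_exponent[OF u] keys_word_exponent[OF v]]
      word_exponent_diff_in_lattice[OF n] by simp
next
  let ?Z = "free_Abelian_group {1..n}"
  interpret G: comm_group "G_group n" by (rule comm_group_G_group)
  have car: "class_G n w \<in> carrier (G_group n)" if "w \<in> lists ({1..n} \<times> UNIV)" for w
    using that carrier_G_group by blast
  have "(\<lambda>i. class_G n [(i, True)]) ` {1..n} \<subseteq> carrier (G_group n)"
    by (auto intro!: car)
  then obtain \<psi> where hom: "\<psi> \<in> hom ?Z (G_group n)"
    and gen: "\<And>i. i \<in> {1..n} \<Longrightarrow> \<psi> (frag_of i) = class_G n [(i, True)]"
    by (rule G.free_Abelian_group_universal) blast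
  interpret \<psi>: group_hom ?Z "G_group n" \<psi>
    using hom by (simp add: group_hom_def group_hom_axioms_def)
  have \<psi>_word: "\<psi> (word_exponent w) = class_G n w" if "w \<in> lists ({1..n} \<times> UNIV)" for w
    using that
  proof (induction w)
    case Nil
    show ?case using \<psi>.hom_one by (simp add: class_G_Nil)
  next
    case (Cons a w)
    obtain i b where a: "a = (i, b)" by (cases a)
    have i: "i \<in> {1..n}" and w: "w \<in> lists ({1..n} \<times> UNIV)" using Cons a by auto
    have letter: "\<psi> (if b then frag_of i else - frag_of i) = class_G n [(i, b)]"
      using gen[OF i] \<psi>.hom_inv[of "frag_of i"] i class_G_inverse[OF i] by simp
    have "\<psi> (word_exponent (a # w)) = \<psi> (if b then frag_of i else - frag_of i) \<otimes>\<^bsub>G_group n\<^esub> \<psi> (word_exponent w)"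
      using \<psi>.hom_mult[of "if b then frag_of i else - frag_of i" "word_exponent w"]
        keys_word_exponent[OF w] i a by simp
    also have "\<dots> = class_G n ([(i, b)] @ w)"
      unfolding letter Cons.IH by (rule class_G_append[symmetric]) (use i w in auto)
    finally show ?case using a by simp
  qed
  have kernel_iff: "word_exponent u - word_exponent v \<in> kernel ?Z (G_group n) \<psi> \<longleftrightarrow> (u, v) \<in> cong_G n"
    if u: "u \<in> lists ({1..n} \<times> UNIV)" and v: "v \<in> lists ({1..n} \<times> UNIV)" for u v
  proof -
    note keys = keys_word_exponent[OF u] keys_word_exponent[OF v]
    have "word_exponent u - word_exponent v \<in> carrier ?Z"
      using keys keys_diff[of "word_exponent u" "word_exponent v"] by auto
    moreover have "\<psi> (word_exponent u - word_exponent v) = class_G n u \<otimes>\<^bsub>G_group n\<^esub> inv\<^bsub>G_group n\<^esub> class_G n v"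
      using \<psi>.hom_mult[of "word_exponent u" "- word_exponent v"] \<psi>.hom_inv[of "word_exponent v"] keys
      by (simp add: \<psi>_word[OF u] \<psi>_word[OF v])
    moreover have "class_G n u \<otimes>\<^bsub>G_group n\<^esub> inv\<^bsub>G_group n\<^esub> class_G n v = \<one>\<^bsub>G_group n\<^esub> \<longleftrightarrow>
        class_G n u = class_G n v"
      unfolding G.inv_solve_right'[OF G.one_closed car[OF u] car[OF v]] G.l_one[OF car[OF v]] ..
    ultimately have "word_exponent u - word_exponent v \<in> kernel ?Z (G_group n) \<psi> \<longleftrightarrow> class_G n u = class_G n v"
      unfolding kernel_def by (simp only: mem_Collect_eq simp_thms)
    then show ?thesis unfolding class_G_eq_iff[OF u v] .
  qed
  have K: "exponent_subgroup n (kernel ?Z (G_group n) \<psi>)"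
    by (rule exponent_subgroup.intro[OF \<psi>.subgroup_kernel])
  have "lattice_L n \<subseteq> kernel ?Z (G_group n) \<psi>"
  proof (rule lattice_L_subset[OF K generators_from_first_family(2)[OF K n]])
    fix k assume k: "k \<in> {1..n}"
    let ?u = "map (\<lambda>j. (j, True)) (filter (\<lambda>j. j \<noteq> k) [1..<Suc n])"
    have words: "?u \<in> lists ({1..n} \<times> UNIV)" "[(k, True)] \<in> lists ({1..n} \<times> UNIV)"
      using k by auto
    have "(?u, [(k, True)]) \<in> cong_G n"
      by (rule word_cong.relation[OF _ words]) (use k in \<open>auto simp: relations_G_def\<close>)
    then have "([(k, True)], ?u) \<in> cong_G n" by (rule word_cong.sym)
    then show "frag_cmul 2 (frag_of k) - (\<Sum>j = 1..n. frag_of j) \<in> kernel ?Z (G_group n) \<psi>"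
      using kernel_iff[OF words(2,1)] unfolding word_exponent_relation[OF k] by (simp only:)
  qed
  moreover assume "lattice_class n (word_exponent u) = lattice_class n (word_exponent v)"
  then have "word_exponent u - word_exponent v \<in> lattice_L n"
    using lattice_class_eq_iff[OF n keys_word_exponent[OF u] keys_word_exponent[OF v]] by simp
  ultimately show "(u, v) \<in> cong_G n"
    unfolding kernel_iff[OF u v, symmetric] by (rule subsetD)
qed

lemma bij_betw_quotient_image:
  assumes equiv: "equiv A r" and r: "\<And>x y. x \<in> A \<Longrightarrow> y \<in> A \<Longrightarrow> (x, y) \<in> r \<longleftrightarrow> f x = f y"
  shows "bij_betw (\<lambda>c. the_elem (f ` c)) (A // r) (f ` A)"
proof -
  have val: "the_elem (f ` (r `` {x})) = f x" if x: "x \<in> A" for x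
  proof -
    have "f y = f x" if "(x, y) \<in> r" for y
      using r[OF x, of y] equiv_type[OF equiv] that by auto
    then have "f ` (r `` {x}) = {f x}"
      using equiv_class_self[OF equiv x] by blast
    then show ?thesis by simp
  qed
  have quot: "A // r = (\<lambda>x. r `` {x}) ` A"
    by (auto simp: quotient_def)
  show ?thesis
    unfolding bij_betw_def quot
  proof
    show "inj_on (\<lambda>c. the_elem (f ` c)) ((\<lambda>x. r `` {x}) ` A)"
    proof (rule inj_onI, elim imageE)
      fix c d x y
      assume eq: "the_elem (f ` c) = the_elem (f ` d)"
        and x: "x \<in> A" "c = r `` {x}" and y: "y \<in> A" "d = r `` {y}"
      then have "f x = f y" by (simp only: val)
      then have "(x, y) \<in> r" using r[OF x(1) y(1)] by simp
      then show "c = d" unfolding x y by (rule equiv_class_eq[OF equiv])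
    qed
    show "(\<lambda>c. the_elem (f ` c)) ` ((\<lambda>x. r `` {x}) ` A) = f ` A"
      unfolding image_image by (rule image_cong[OF HOL.refl val])
  qed
qed

theorem G_group_equipollent_lattice_quotient:
  assumes n: "n \<ge> 3"
  shows "\<exists>h. bij_betw h (carrier (G_group n)) (carrier (lattice_quotient n))"
proof -
  let ?W = "lists ({1..n} \<times> (UNIV :: bool set))"
  have "carrier (lattice_quotient n) = (\<lambda>w. lattice_class n (word_exponent w)) ` ?W"
    unfolding carrier_lattice_quotient
  proof (intro subset_antisym image_subsetI)
    fix d :: "nat \<Rightarrow>\<^sub>0 int"
    assume "d \<in> {d. Poly_Mapping.keys d \<subseteq> {1..n}}"
    then obtain w where "w \<in> ?W" "word_exponent w = d"
      using word_exponent_surj[of d n] by blast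
    then show "lattice_class n d \<in> (\<lambda>w. lattice_class n (word_exponent w)) ` ?W"
      by blast
  next
    fix w :: "nat word"
    assume "w \<in> ?W"
    from keys_word_exponent[OF this]
    show "lattice_class n (word_exponent w) \<in> lattice_class n ` {d. Poly_Mapping.keys d \<subseteq> {1..n}}"
      by (intro imageI CollectI)
  qed
  moreover have "carrier (G_group n) = ?W // cong_G n"
    by (simp only: G_group_eq presented_group_def partial_object.simps)
  moreover have "bij_betw (\<lambda>c. the_elem ((\<lambda>w. lattice_class n (word_exponent w)) ` c))
      (?W // cong_G n) ((\<lambda>w. lattice_class n (word_exponent w)) ` ?W)"
    by (rule bij_betw_quotient_image[OF equiv_word_cong cong_G_iff[OF n]])
  ultimately show ?thesis
    by (simp only:) (rule exI)
qed

section \<open>The theorem\<close>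

theorem theorem4p5:
  fixes n :: nat
  assumes "n \<ge> 3"
  shows "(\<exists>\<phi> \<in> algebra_iso
            (quotient_algebra n
              (lattice_ideal n :: 'a::{alg_closed_field, field_char_0} mpoly set))
            (group_algebra (lattice_quotient n)).
            \<forall>i \<in> {1..n}.
              \<phi> (lattice_ideal n +>\<^bsub>mpoly_ring n\<^esub> mvar i)
                = Poly_Mapping.single (lattice_L n #>\<^bsub>free_Abelian_group {1..n}\<^esub> frag_of i) 1)
    \<and> (finite_codimension n (lattice_ideal n :: 'a mpoly set) \<longrightarrow>
        finite (carrier (lattice_quotient n)) \<and>
        colength (mpoly_ring n) (lattice_ideal n :: 'a mpoly set)
          = enat (Coset.order (lattice_quotient n)))
    \<and> (finite (carrier (G_group n)) \<and>
        colength (mpoly_ring n) (lattice_ideal n :: 'a mpoly set) = enat (Coset.order (G_group n)))"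
proof -
  let ?Q = "lattice_quotient n"
  obtain \<phi> where iso: "\<phi> \<in> algebra_iso (quotient_algebra n (lattice_ideal n :: 'a mpoly set)) (group_algebra ?Q)"
    and val: "\<And>p. p \<in> carrier (mpoly_ring n) \<Longrightarrow>
      \<phi> (lattice_ideal n +>\<^bsub>mpoly_ring n\<^esub> p) = lattice_projection n p"
    using lattice_algebra_iso[OF assms] by blast
  have var: "\<phi> (lattice_ideal n +>\<^bsub>mpoly_ring n\<^esub> mvar i)
      = Poly_Mapping.single (lattice_L n #>\<^bsub>free_Abelian_group {1..n}\<^esub> frag_of i) 1"
    if "i \<in> {1..n}" for i
  proof -
    have "lattice_projection n (mvar i :: 'a mpoly) = Poly_Mapping.single (lattice_class n (frag_of i)) 1"
      using int_exponent_single[of i 1] by (simp add: mvar_def)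
    then show ?thesis
      unfolding val[OF mvar_in_mpoly_ring[OF that]] lattice_class_def .
  qed
  obtain h where "bij_betw h (carrier (G_group n)) (carrier ?Q)"
    using G_group_equipollent_lattice_quotient[OF assms] by blast
  then have "finite (carrier (G_group n))" "Coset.order (G_group n) = Coset.order ?Q"
    using bij_betw_finite bij_betw_same_card finite_lattice_quotient[OF assms]
    by (auto simp: Coset.order_def)
  then show ?thesis
    using iso var finite_lattice_quotient[OF assms]
      colength_lattice_ideal[OF assms, where 'a = 'a] by (intro conjI bexI[of _ \<phi>]) simp_all
qed

end
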